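(* Fix constants $L,\beta,c,D,T>0$, $\theta\in(0,1]$. Let $\mathcal F_{reg1}$ be the set of all distributions of $(\mathbf X,Y)$, $\mathbf X\in\mathcal X\subseteq\mathbb R^d$, $Y\in\mathbb R$, such that: $\eta(\mathbf x)=\mathbb E[Y\mid\mathbf X=\mathbf x]$ satisfies $|\eta(\mathbf x)-\eta(\mathbf x')|\le L\|\mathbf x-\mathbf x'\|^\beta$; $\mathbf X$ has density $f\ge c$ on $\mathcal X$; $\mathrm{vol}(B(\mathbf x,r)\cap\mathcal X)\ge\theta v_dr^d$ for all $\mathbf x\in\mathcal X$, $r<D$; and $P(|Y|<T\mid\mathbf X=\mathbf x)=1$ for all $\mathbf x$. Let $\mathcal M_\epsilon$ be the set of all $\epsilon$-label LDP mechanisms. Given $N$ i.i.d. samples, the learner observes $(\mathbf X_i,Z_i)$ with $Z_i=M(\mathbf X_i,Y_i)$ and outputs $\hat\eta$. Then $$\inf_{\hat\eta}\ \inf_{M\in\mathcal M_\epsilon}\ \sup_{\mathcal F_{reg1}}(R_{reg}-R_{reg}^* )\gtrsim\big(N(\epsilon^2\wedge1)\big)^{-\frac{2\beta}{d+2\beta}}.$$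
   Context: $\epsilon$-label LDP: a randomized map $M$ with $\sup_{y,y'}\sup_S\ln\frac{P(M(\mathbf x,y)\in S)}{P(M(\mathbf x,y')\in S)}\le\epsilon$ for all $\mathbf x$. $R_{reg}=\mathbb E[(\hat\eta(\mathbf X)-Y)^2]$ for an independent test pair (averaged over training data and mechanism), $R^*_{reg}=\mathbb E[(Y-\eta(\mathbf X))^2]$. $v_d$ is the volume of the unit ball. $\gtrsim$: up to a constant independent of $N,\epsilon$.
   Formalization: Proved for β ≤ 1 (for β > 1 on e.g. a cube η is constant and the bound fails) and for N(ε²∧1) above a fixed threshold (the risk is bounded as ε→0); 𝒳 is a fixed nonempty Borel set with c·vol(𝒳) ≤ 1; the constant may formally depend on the carrier of the mechanism's outputs. *)

theory Defs
  imports "HOL-Probability.Probability"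
begin

definition vol_cond :: "'a::euclidean_space set \<Rightarrow> real \<Rightarrow> real \<Rightarrow> bool" where
  "vol_cond X \<theta> D \<longleftrightarrow>
     (\<forall>x\<in>X. \<forall>r. 0 < r \<and> r < D \<longrightarrow>
        emeasure lborel (ball x r \<inter> X)
          \<ge> ennreal (\<theta> * measure lborel (ball (0::'a) 1) * r ^ DIM('a)))"

definition is_regression_fun :: "('a::euclidean_space \<times> real) measure \<Rightarrow> ('a \<Rightarrow> real) \<Rightarrow> bool" where
  "is_regression_fun P \<eta> \<longleftrightarrow>
     \<eta> \<in> borel_measurable borel \<and>
     integrable (distr P borel fst) \<eta> \<and>
     (\<forall>A \<in> sets borel.
        (\<integral>p. indicator A (fst p) * snd p \<partial>P) = (\<integral>x. indicator A x * \<eta> x \<partial>(distr P borel fst)))"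

definition F_reg1 ::
  "'a::euclidean_space set \<Rightarrow> real \<Rightarrow> real \<Rightarrow> real \<Rightarrow> real \<Rightarrow> real \<Rightarrow> real
     \<Rightarrow> ('a \<times> real) measure \<Rightarrow> ('a \<Rightarrow> real) \<Rightarrow> bool" where
  "F_reg1 X L \<beta> c D T \<theta> P \<eta> \<longleftrightarrow>
     prob_space P \<and> sets P = sets borel \<and>
     is_regression_fun P \<eta> \<and>
     (\<forall>x\<in>X. \<forall>x'\<in>X. \<bar>\<eta> x - \<eta> x'\<bar> \<le> L * norm (x - x') powr \<beta>) \<and>
     (\<exists>f. f \<in> borel_measurable borel \<and> (\<forall>x. f x \<ge> 0) \<and> (\<forall>x\<in>X. f x \<ge> c) \<and>
          distr P borel fst = density lborel (\<lambda>x. ennreal (f x))) \<and>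
     (AE p in P. fst p \<in> X) \<and>
     vol_cond X \<theta> D \<and>
     (AE p in P. \<bar>snd p\<bar> < T)"

definition label_LDP :: "real \<Rightarrow> 'z measure \<Rightarrow> ('a::euclidean_space \<times> real \<Rightarrow> 'z measure) \<Rightarrow> bool" where
  "label_LDP \<epsilon> Zs M \<longleftrightarrow>
     M \<in> borel \<rightarrow>\<^sub>M prob_algebra Zs \<and>
     (\<forall>x y y' S. S \<in> sets Zs \<longrightarrow>
        measure (M (x, y)) S \<le> exp \<epsilon> * measure (M (x, y')) S)"

definition priv_law :: "('a::euclidean_space \<times> real) measure \<Rightarrow> 'z measure \<Rightarrow> ('a \<times> real \<Rightarrow> 'z measure)
     \<Rightarrow> ('a \<times> 'z) measure" where
  "priv_law P Zs M = P \<bind> (\<lambda>p. distr (M p) (borel \<Otimes>\<^sub>M Zs) (\<lambda>z. (fst p, z)))"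

definition sample_space :: "nat \<Rightarrow> 'z measure \<Rightarrow> (nat \<Rightarrow> 'a::euclidean_space \<times> 'z) measure" where
  "sample_space N Zs = PiM {..<N} (\<lambda>_. borel \<Otimes>\<^sub>M Zs)"

definition estimator :: "nat \<Rightarrow> 'z measure \<Rightarrow> ((nat \<Rightarrow> 'a::euclidean_space \<times> 'z) \<Rightarrow> 'a \<Rightarrow> real) \<Rightarrow> bool" where
  "estimator N Zs est \<longleftrightarrow>
     (\<lambda>(s, x). est s x) \<in> borel_measurable (sample_space N Zs \<Otimes>\<^sub>M borel)"

text \<open>R_reg: expected squared loss on an independent test pair, averaged over training data
  and mechanism (as an extended nonnegative real, so infinite risk is allowed).\<close>
definition R_reg :: "nat \<Rightarrow> ('a::euclidean_space \<times> real) measure \<Rightarrow> 'z measure \<Rightarrow> ('a \<times> real \<Rightarrow> 'z measure)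
     \<Rightarrow> ((nat \<Rightarrow> 'a \<times> 'z) \<Rightarrow> 'a \<Rightarrow> real) \<Rightarrow> ennreal" where
  "R_reg N P Zs M est =
     (\<integral>\<^sup>+ s. (\<integral>\<^sup>+ p. ennreal ((est s (fst p) - snd p)\<^sup>2) \<partial>P) \<partial>(PiM {..<N} (\<lambda>_. priv_law P Zs M)))"

definition R_reg_star :: "('a::euclidean_space \<times> real) measure \<Rightarrow> ('a \<Rightarrow> real) \<Rightarrow> real" where
  "R_reg_star P \<eta> = (\<integral>p. (snd p - \<eta> (fst p))\<^sup>2 \<partial>P)"

end

theory Submission
  imports Defs
begin

text \<open>
  Let \<open>X\<close> be uniform and \<open>Y = \<plusminus>\<tau>\<close> with \<open>\<tau> = T/2\<close>, and let \<open>\<eta>\<close> range over sums of signed bumps of width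
  \<open>h\<close> and height of order \<open>h\<^sup>\<beta>\<close> centred at a maximal \<open>2h\<close>-separated subset of the support.
  If \<open>A\<^sub>+\<close> and \<open>A\<^sub>-\<close> are the laws of \<open>(X, Z)\<close> when all labels are \<open>\<tau>\<close> resp. \<open>-\<tau>\<close>, privacy bounds
  the ratio of the two by \<open>exp \<epsilon>\<close>. Hence with respect to their average \<open>\<mu>\<close> the privatised law has
  density \<open>1 + (\<eta>/\<tau>) b\<close> with \<open>\<bar>b\<bar> \<le> min \<epsilon> 1\<close>. Flipping one sign therefore lowers the Hellinger affinity by
  at most order \<open>(\<epsilon>\<^sup>2 \<and> 1) h\<^bsup>2\<beta> + d\<^esup>\<close> per observation, and affinities multiply over the sample.
  When \<open>N (\<epsilon>\<^sup>2 \<and> 1) h\<^bsup>2\<beta> + d\<^esup>\<close> is a small constant no sign can be identified, so averaging over all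
  sign patterns (Assouad) leaves an excess risk of order \<open>h\<^bsup>2\<beta>\<^esup>\<close>.
\<close>

section \<open>Signed sums of bumps on a packing\<close>

text \<open>Subadditivity of \<open>t powr \<beta>\<close> for \<beta> at most 1: a fraction in
  [0, 1] can only grow when raised to the power \<beta>, and \<open>s / (s + t)\<close> and
  \<open>t / (s + t)\<close> add up to 1.\<close>

lemma powr_diff_le_powr_abs_diff:
  fixes a b \<beta> :: real
  assumes "0 \<le> a" "0 \<le> b" "0 < \<beta>" "\<beta> \<le> 1"
  shows "\<bar>a powr \<beta> - b powr \<beta>\<bar> \<le> \<bar>a - b\<bar> powr \<beta>"
proof -
  have subadd: "(s + t) powr \<beta> \<le> s powr \<beta> + t powr \<beta>" if "0 \<le> s" "0 \<le> t" for s t :: real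
  proof (cases "s + t = 0")
    case True
    then show ?thesis using that by simp
  next
    case False
    then have pos: "s + t > 0" using that by simp
    have *: "r / (s + t) \<le> (r / (s + t)) powr \<beta>" if "0 \<le> r" "r \<le> s + t" for r
      using powr_mono'[of \<beta> 1 "r / (s + t)"] that pos assms by auto
    have "1 = s / (s + t) + t / (s + t)" using pos by (simp add: add_divide_distrib[symmetric])
    also have "\<dots> \<le> (s / (s + t)) powr \<beta> + (t / (s + t)) powr \<beta>"
      using *[of s] *[of t] that by simp
    also have "\<dots> = (s powr \<beta> + t powr \<beta>) / (s + t) powr \<beta>"
      using that pos by (simp add: powr_divide add_divide_distrib)
    finally show ?thesis using pos by (simp add: pos_le_divide_eq)
  qed
  show ?thesis
  proof (cases "a \<le> b")
    case True
    then have "b powr \<beta> \<le> a powr \<beta> + (b - a) powr \<beta>" "a powr \<beta> \<le> b powr \<beta>"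
      using subadd[of a "b - a"] assms by (auto intro: powr_mono2)
    then show ?thesis using True by simp
  next
    case False
    then have "a powr \<beta> \<le> b powr \<beta> + (a - b) powr \<beta>" "b powr \<beta> \<le> a powr \<beta>"
      using subadd[of b "a - b"] assms by (auto intro: powr_mono2)
    then show ?thesis using False by simp
  qed
qed

section \<open>Bumps with disjoint supports and their Hoelder regularity\<close>

definition separated :: "real \<Rightarrow> 'a::metric_space set \<Rightarrow> bool" where
  "separated r J \<longleftrightarrow> (\<forall>i\<in>J. \<forall>j\<in>J. i \<noteq> j \<longrightarrow> r \<le> dist i j)"

text \<open>A sign pattern is encoded by the set of centres with positive sign. Flipping one sign is
  then inserting a point, and averaging over patterns is a sum over \<open>Pow J\<close>.\<close>

definition bump_sign :: "'a set \<Rightarrow> 'a \<Rightarrow> real" where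
  "bump_sign V j = (if j \<in> V then 1 else -1)"

text \<open>A cone raised to the power \<beta>; for exponents in (0, 1] it is Hoelder with constant
  1. Because \<open>0 powr \<beta>\<close> is 0, it vanishes from distance \<open>h\<close> on, the
  boundary sphere included.\<close>

definition bump :: "real \<Rightarrow> real \<Rightarrow> 'a::metric_space \<Rightarrow> 'a \<Rightarrow> real" where
  "bump h \<beta> j x = max 0 (h - dist x j) powr \<beta>"

definition bump_sum :: "real \<Rightarrow> real \<Rightarrow> real \<Rightarrow> 'a::metric_space set \<Rightarrow> 'a set \<Rightarrow> 'a \<Rightarrow> real" where
  "bump_sum A h \<beta> J V x = (\<Sum>j\<in>J. bump_sign V j * (A * bump h \<beta> j x))"

lemma bump_eq_0: "h \<le> dist x j \<Longrightarrow> bump h \<beta> j x = 0"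
  by (simp add: bump_def max_def)

lemma bump_nonneg: "0 \<le> bump h \<beta> j x"
  by (simp add: bump_def)

lemma bump_le: "0 < h \<Longrightarrow> 0 < \<beta> \<Longrightarrow> bump h \<beta> j x \<le> h powr \<beta>"
  by (auto simp: bump_def intro!: powr_mono2)

lemma bump_ge:
  assumes "x \<in> ball j (h/2)" "0 < h" "0 < \<beta>"
  shows "(h/2) powr \<beta> \<le> bump h \<beta> j x"
  using assms by (auto simp: bump_def dist_commute intro!: powr_mono2)

text \<open>By the triangle inequality a point within \<open>h\<close> of one centre is at least
  \<open>h\<close> away from all others, so a single term survives. The case
  \<open>dist x j = h\<close> can be included because every bump vanishes there.\<close>

lemma bump_sum_eq_single:
  assumes "finite J" "separated (2*h) J" "j \<in> J" "dist x j \<le> h"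
  shows "bump_sum A h \<beta> J V x = bump_sign V j * (A * bump h \<beta> j x)"
proof -
  have "bump h \<beta> i x = 0" if "i \<in> J" "i \<noteq> j" for i
  proof (rule bump_eq_0)
    have "2*h \<le> dist i j" using assms that by (auto simp: separated_def)
    also have "\<dots> \<le> dist x i + dist x j" by (metis dist_commute dist_triangle)
    finally show "h \<le> dist x i" using assms by simp
  qed
  then show ?thesis
    unfolding bump_sum_def using assms
    by (subst sum.remove[of _ j]) (auto intro!: sum.neutral)
qed

lemma bump_sum_eq_0:
  assumes "\<And>j. j \<in> J \<Longrightarrow> h \<le> dist x j"
  shows "bump_sum A h \<beta> J V x = 0"
  unfolding bump_sum_def by (intro sum.neutral) (auto simp: bump_eq_0 assms)

lemma bump_sum_abs_le:
  assumes "finite J" "separated (2*h) J" "0 < h" "0 < \<beta>" "0 \<le> A"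
  shows "\<bar>bump_sum A h \<beta> J V x\<bar> \<le> A * h powr \<beta>"
proof (cases "\<exists>j\<in>J. dist x j \<le> h")
  case True
  then obtain j where "j \<in> J" "dist x j \<le> h" by auto
  then show ?thesis
    using bump_sum_eq_single[OF assms(1,2), of j x A \<beta> V] bump_le[of h \<beta> j x] assms
    by (auto simp: bump_sign_def abs_mult bump_nonneg intro!: mult_left_mono)
next
  case False
  then have "bump_sum A h \<beta> J V x = 0" by (intro bump_sum_eq_0) force
  then show ?thesis using assms by simp
qed

lemma bump_sum_measurable [measurable]:
  fixes J :: "'a::euclidean_space set"
  shows "bump_sum A h \<beta> J V \<in> borel_measurable borel"
  unfolding bump_sum_def[abs_def] bump_def by measurable

text \<open>If one support contains both points, the bound for a single bump applies. Otherwise each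
  value is bounded on its own: the depth of a point inside a support is at most its distance to a
  point outside. Adding the two bounds produces the factor 2.\<close>

lemma bump_sum_holder:
  fixes J :: "'a::euclidean_space set"
  assumes fin: "finite J" and sep: "separated (2*h) J" and "0 < h" "0 < \<beta>" "\<beta> \<le> 1" "0 \<le> A"
  shows "\<bar>bump_sum A h \<beta> J V x - bump_sum A h \<beta> J V y\<bar> \<le> 2 * A * norm (x - y) powr \<beta>"
proof -
  have single: "A * bump h \<beta> j x \<le> A * norm (x - y) powr \<beta>" if "h \<le> dist y j" for x y j :: 'a
  proof -
    have "max 0 (h - dist x j) \<le> dist x y"
      using that dist_triangle[of y j x] by (auto simp: dist_commute)
    then show ?thesis
      unfolding bump_def using assms
      by (intro mult_left_mono powr_mono2) (auto simp: dist_norm)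
  qed
  have far: "\<bar>bump_sum A h \<beta> J V x\<bar> \<le> A * norm (x - y) powr \<beta>"
    if "j \<in> J" "dist x j < h" "h \<le> dist y j" for x y j :: 'a
    using bump_sum_eq_single[OF fin sep, of j x A \<beta> V] single[of y j x] that assms
    by (auto simp: bump_sign_def abs_mult bump_nonneg)
  consider j where "j \<in> J" "dist x j < h" "dist y j < h"
    | "\<And>j. j \<in> J \<Longrightarrow> dist x j < h \<Longrightarrow> h \<le> dist y j" by force
  then show ?thesis
  proof cases
    case 1
    have "\<bar>bump_sum A h \<beta> J V x - bump_sum A h \<beta> J V y\<bar> = A * \<bar>bump h \<beta> j x - bump h \<beta> j y\<bar>"
      using bump_sum_eq_single[OF fin sep 1(1), of x A \<beta> V]
        bump_sum_eq_single[OF fin sep 1(1), of y A \<beta> V] 1 assms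
      by (auto simp: bump_sign_def abs_mult right_diff_distrib[symmetric] abs_minus_commute)
    also have "\<dots> \<le> A * \<bar>max 0 (h - dist x j) - max 0 (h - dist y j)\<bar> powr \<beta>"
      unfolding bump_def using assms by (intro mult_left_mono powr_diff_le_powr_abs_diff) auto
    also have "\<dots> \<le> A * norm (x - y) powr \<beta>"
    proof -
      have "\<bar>dist x j - dist y j\<bar> \<le> norm (x - y)"
        by (metis abs_dist_diff_le dist_commute dist_norm)
      then show ?thesis using assms 1 by (intro mult_left_mono powr_mono2) auto
    qed
    also have "\<dots> \<le> 2 * A * norm (x - y) powr \<beta>" using assms by auto
    finally show ?thesis .
  next
    case 2
    have *: "\<bar>bump_sum A h \<beta> J V x\<bar> \<le> A * norm (x - y) powr \<beta>"
    proof (cases "\<exists>j\<in>J. dist x j < h")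
      case True then show ?thesis using far 2 by blast
    next
      case False
      then show ?thesis using bump_sum_eq_0[of J h x A \<beta> V] assms by (force simp: not_less)
    qed
    have **: "\<bar>bump_sum A h \<beta> J V y\<bar> \<le> A * norm (y - x) powr \<beta>"
    proof (cases "\<exists>j\<in>J. dist y j < h")
      case True
      then show ?thesis using far[of _ y x] 2 by (meson not_less)
    next
      case False
      then show ?thesis using bump_sum_eq_0[of J h y A \<beta> V] assms by (force simp: not_less)
    qed
    show ?thesis using * ** by (simp add: norm_minus_commute)
  qed
qed

text \<open>\<open>J\<close> is a separated subset of \<open>X\<close> of largest cardinality.
  Cardinalities are bounded because the pieces \<open>ball j h \<inter> X\<close> are disjoint and
  \<open>vol_cond\<close> bounds the volume of each from below. Maximality forces the balls of
  radius \<open>2*h\<close> to cover \<open>X\<close>, which gives the lower bound on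
  \<open>card J\<close>.\<close>

lemma exists_packing:
  fixes X :: "'a::euclidean_space set"
  assumes vc: "vol_cond X \<theta> D" and [measurable]: "X \<in> sets borel"
    and fin: "emeasure lborel X < \<infinity>" and h: "0 < h" "h < D" and "0 < \<theta>"
  shows "\<exists>J\<subseteq>X. finite J \<and> separated (2*h) J \<and>
     measure lborel X \<le> real (card J) * (measure lborel (ball (0::'a) 1) * (2*h) ^ DIM('a))"
proof -
  define v where "v = measure lborel (ball (0::'a) 1)"
  have v: "v > 0" unfolding v_def by (rule content_ball_pos) simp
  have fmX: "X \<in> fmeasurable lborel" using fin by (auto simp: fmeasurable_def)
  define Q where "Q J \<longleftrightarrow> J \<subseteq> X \<and> finite J \<and> separated (2*h) J" for J
  define K where "K = measure lborel X / (\<theta> * v * h ^ DIM('a))"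
  have bound: "real (card J) \<le> K" if "Q J" for J
  proof -
    have J: "J \<subseteq> X" "finite J" "separated (2*h) J" using that by (auto simp: Q_def)
    have disj: "disjoint_family_on (\<lambda>j. ball j h \<inter> X) J"
      unfolding disjoint_family_on_def
    proof (intro ballI impI)
      fix i j assume ij: "i \<in> J" "j \<in> J" "i \<noteq> j"
      then have "2*h \<le> dist i j" using J(3) by (auto simp: separated_def)
      moreover have "dist i j < 2*h" if "z \<in> ball i h" "z \<in> ball j h" for z
        using that dist_triangle[of i j z] by (auto simp: dist_commute)
      ultimately show "(ball i h \<inter> X) \<inter> (ball j h \<inter> X) = {}" by force
    qed
    have "\<theta> * v * h ^ DIM('a) \<le> measure lborel (ball j h \<inter> X)" if "j \<in> J" for j
    proof -
      have "ennreal (\<theta> * v * h ^ DIM('a)) \<le> emeasure lborel (ball j h \<inter> X)"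
        using vc that J h unfolding vol_cond_def v_def by blast
      also have "\<dots> = ennreal (measure lborel (ball j h \<inter> X))"
        by (rule emeasure_eq_ennreal_measure)
          (metis emeasure_mono fin Int_lower2 infinity_ennreal_def leD lborelD assms(2) sets_lborel top.not_eq_extremum)
      finally show ?thesis by (subst (asm) ennreal_le_iff) auto
    qed
    then have "(\<Sum>j\<in>J. \<theta> * v * h ^ DIM('a)) \<le> (\<Sum>j\<in>J. measure lborel (ball j h \<inter> X))"
      by (intro sum_mono) auto
    also have "\<dots> = measure lborel (\<Union>j\<in>J. ball j h \<inter> X)"
      using J disj fmX
      by (intro measure_finite_Union[symmetric])
        (auto intro!: fmeasurableD2 fmeasurable_Int_fmeasurable simp: Int_commute[of _ X])
    also have "\<dots> \<le> measure lborel X"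
    proof (intro measure_mono_fmeasurable fmX)
      have "(\<Union>j\<in>J. ball j h) \<inter> X \<in> sets borel" by (intro sets.Int borel_open assms(2)) auto
      then show "(\<Union>j\<in>J. ball j h \<inter> X) \<in> sets lborel" by simp
    qed auto
    finally show ?thesis using v h \<open>0 < \<theta>\<close> by (simp add: K_def pos_le_divide_eq)
  qed
  have "Q {}" by (auto simp: Q_def separated_def)
  moreover have "\<forall>J. Q J \<longrightarrow> card J \<le> nat \<lfloor>K\<rfloor>" by (auto dest!: bound simp: le_nat_floor)
  ultimately have "\<exists>J. Q J \<and> (\<forall>J'. Q J' \<longrightarrow> card J' \<le> card J)"
    using ex_has_greatest_nat[of Q "{}" card "Suc (nat \<lfloor>K\<rfloor>)"] by (auto simp: less_Suc_eq_le)
  then obtain J where J: "Q J" and max: "\<And>J'. Q J' \<Longrightarrow> card J' \<le> card J" by blast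
  have cover: "X \<subseteq> (\<Union>j\<in>J. ball j (2*h))"
  proof
    fix x assume x: "x \<in> X"
    show "x \<in> (\<Union>j\<in>J. ball j (2*h))"
    proof (rule ccontr)
      assume n: "x \<notin> (\<Union>j\<in>J. ball j (2*h))"
      then have "x \<notin> J" using h by force
      moreover have "Q (insert x J)"
        using J x n by (auto simp: Q_def separated_def dist_commute not_less)
      ultimately show False using max[of "insert x J"] J by (auto simp: Q_def)
    qed
  qed
  have "measure lborel X \<le> measure lborel (\<Union>j\<in>J. ball j (2*h))"
    using cover J
    by (intro measure_mono_fmeasurable fmeasurable.finite_UN fmeasurableI emeasure_lborel_ball_finite)
      (auto simp: Q_def)
  also have "\<dots> \<le> (\<Sum>j\<in>J. measure lborel (ball j (2*h)))"
    using J by (intro measure_UNION_le) (auto simp: Q_def)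
  also have "\<dots> = real (card J) * (v * (2*h) ^ DIM('a))"
    using content_ball_conv_unit_ball[of "2*h" "_::'a"] h by (simp add: v_def mult.commute)
  finally show ?thesis using J unfolding Q_def v_def by blast
qed

section \<open>Products of densities and the two-point inequality\<close>

text \<open>It suffices to compare the two measures on boxes, where the integrand is a product of
  functions of single coordinates and the integral factorises.\<close>

lemma PiM_density:
  fixes f :: "'i \<Rightarrow> 'b \<Rightarrow> ennreal"
  assumes fin: "finite I" and M: "\<And>i. i \<in> I \<Longrightarrow> prob_space (M i)"
    and f: "\<And>i. i \<in> I \<Longrightarrow> f i \<in> borel_measurable (M i)"
    and D: "\<And>i. i \<in> I \<Longrightarrow> prob_space (density (M i) (f i))"
  shows "PiM I (\<lambda>i. density (M i) (f i)) = density (PiM I M) (\<lambda>s. \<Prod>i\<in>I. f i (s i))"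
proof -
  \<comment> \<open>The locale for products demands a sigma-finite measure at every index, so
    indices outside \<open>I\<close> receive a point mass with density 1. \<open>PiM I\<close>
    ignores them, and the substitution is undone at the end.\<close>
  define M' where "M' i = (if i \<in> I then M i else return (count_space UNIV) undefined)" for i
  define f' where "f' i = (if i \<in> I then f i else (\<lambda>_. 1))" for i
  have pM: "prob_space (M' i)" for i
    by (auto simp: M'_def M intro!: prob_space_return)
  have pD: "prob_space (density (M' i) (f' i))" for i
    using pM[of i] by (auto simp: M'_def f'_def D density_1)
  have mf: "f' i \<in> borel_measurable (M' i)" for i
    by (auto simp: M'_def f'_def f)
  interpret M: product_sigma_finite M'
    using pM by (simp add: product_sigma_finite_def prob_space_imp_sigma_finite)
  interpret D: product_sigma_finite "\<lambda>i. density (M' i) (f' i)"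
    using pD by (simp add: product_sigma_finite_def prob_space_imp_sigma_finite)
  have "density (PiM I M') (\<lambda>s. \<Prod>i\<in>I. f' i (s i)) = PiM I (\<lambda>i. density (M' i) (f' i))"
  proof (rule D.PiM_eqI[OF fin])
    show "sets (density (PiM I M') (\<lambda>s. \<Prod>i\<in>I. f' i (s i))) = sets (PiM I (\<lambda>i. density (M' i) (f' i)))"
      by (auto cong: sets_PiM_cong)
  next
    fix A assume "\<And>i. i \<in> I \<Longrightarrow> A i \<in> sets (density (M' i) (f' i))"
    then have A: "\<And>i. i \<in> I \<Longrightarrow> A i \<in> sets (M' i)" by simp
    have meas: "(\<lambda>s. \<Prod>i\<in>I. f' i (s i)) \<in> borel_measurable (PiM I M')"
      by (intro borel_measurable_prod_ennreal) (rule measurable_compose[OF measurable_component_singleton], auto intro: mf)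
    have "emeasure (density (PiM I M') (\<lambda>s. \<Prod>i\<in>I. f' i (s i))) (Pi\<^sub>E I A)
      = (\<integral>\<^sup>+s. (\<Prod>i\<in>I. f' i (s i)) * indicator (Pi\<^sub>E I A) s \<partial>PiM I M')"
      using A fin by (intro emeasure_density meas) (auto intro!: sets_PiM_I_finite)
    also have "\<dots> = (\<integral>\<^sup>+s. (\<Prod>i\<in>I. f' i (s i) * indicator (A i) (s i)) \<partial>PiM I M')"
    proof (rule nn_integral_cong)
      fix s assume s: "s \<in> space (PiM I M')"
      have "indicator (Pi\<^sub>E I A) s = (\<Prod>i\<in>I. indicator (A i) (s i) :: ennreal)"
      proof (cases "s \<in> Pi\<^sub>E I A")
        case True then show ?thesis by (auto simp: PiE_def Pi_def)
      next
        case False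
        then obtain i where "i \<in> I" "s i \<notin> A i"
          using s by (auto simp: space_PiM PiE_def Pi_def)
        then show ?thesis using False fin by (auto simp: prod_zero_iff indicator_def)
      qed
      then show "(\<Prod>i\<in>I. f' i (s i)) * indicator (Pi\<^sub>E I A) s = (\<Prod>i\<in>I. f' i (s i) * indicator (A i) (s i))"
        by (simp add: prod.distrib)
    qed
    also have "\<dots> = (\<Prod>i\<in>I. \<integral>\<^sup>+x. f' i x * indicator (A i) x \<partial>M' i)"
      using A mf fin by (intro M.product_nn_integral_prod) auto
    also have "\<dots> = (\<Prod>i\<in>I. emeasure (density (M' i) (f' i)) (A i))"
      using A mf by (intro prod.cong) (auto simp: emeasure_density)
    finally show "emeasure (density (PiM I M') (\<lambda>s. \<Prod>i\<in>I. f' i (s i))) (Pi\<^sub>E I A) = \<dots>" .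
  qed
  moreover have "PiM I M' = PiM I M" "PiM I (\<lambda>i. density (M' i) (f' i)) = PiM I (\<lambda>i. density (M i) (f i))"
    by (auto intro!: PiM_cong simp: M'_def f'_def)
  moreover have "(\<lambda>s. \<Prod>i\<in>I. f' i (s i)) = (\<lambda>s. \<Prod>i\<in>I. f i (s i))"
    by (auto intro!: prod.cong simp: f'_def)
  ultimately show ?thesis by simp
qed

text \<open>The right side minus the left side is the sum of the two squares in the proof. Here
  \<open>e\<close> is an estimate of a target that is \<open>g\<close> or \<open>-g\<close>, and
  \<open>B\<close> is a free weight, later a lower bound on the Hellinger affinity.\<close>

lemma two_point_pointwise:
  fixes e g B p q :: real
  assumes "0 \<le> p" "0 \<le> q"
  shows "4 * g\<^sup>2 * B * sqrt (p * q) \<le> (e - g)\<^sup>2 * p + (e + g)\<^sup>2 * q + (g * B)\<^sup>2 * (p + q)"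
proof -
  define a b where "a = sqrt p" and "b = sqrt q"
  have ab: "p = a\<^sup>2" "q = b\<^sup>2" "sqrt (p * q) = a * b"
    using assms by (auto simp: a_def b_def real_sqrt_mult)
  have "0 \<le> ((e - g) * a + g * B * b)\<^sup>2 + ((e + g) * b - g * B * a)\<^sup>2" by simp
  then show ?thesis unfolding ab(3) unfolding ab(1,2)
    by (simp add: power2_eq_square algebra_simps)
qed

text \<open>A two-point bound for squared loss: integrating the pointwise inequality gives 4 g^2 B
  times the affinity on the left and an additional 2 (g B)^2 on the right. With affinity at least
  \<open>B\<close>, the difference is at least 2 g^2 B^2.\<close>

lemma two_point_bound:
  fixes e p q :: "'b \<Rightarrow> real" and g B :: real
  assumes [measurable]: "e \<in> borel_measurable \<nu>" "p \<in> borel_measurable \<nu>" "q \<in> borel_measurable \<nu>"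
    and nn: "\<And>s. s \<in> space \<nu> \<Longrightarrow> 0 \<le> p s" "\<And>s. s \<in> space \<nu> \<Longrightarrow> 0 \<le> q s"
    and p1: "(\<integral>\<^sup>+s. ennreal (p s) \<partial>\<nu>) = 1" and q1: "(\<integral>\<^sup>+s. ennreal (q s) \<partial>\<nu>) = 1"
    and B: "0 \<le> B" "ennreal B \<le> (\<integral>\<^sup>+s. ennreal (sqrt (p s * q s)) \<partial>\<nu>)"
  shows "ennreal (2 * g\<^sup>2 * B\<^sup>2)
    \<le> (\<integral>\<^sup>+s. ennreal ((e s - g)\<^sup>2) \<partial>density \<nu> p) + (\<integral>\<^sup>+s. ennreal ((e s + g)\<^sup>2) \<partial>density \<nu> q)"
    (is "_ \<le> ?S")
proof -
  have S: "?S = (\<integral>\<^sup>+s. ennreal ((e s - g)\<^sup>2 * p s + (e s + g)\<^sup>2 * q s) \<partial>\<nu>)"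
    by (simp add: nn_integral_density nn_integral_add[symmetric], intro nn_integral_cong)
      (auto simp: nn ennreal_mult' mult.commute)
  have "ennreal (4 * g\<^sup>2 * B\<^sup>2) = ennreal (4 * g\<^sup>2 * B) * ennreal B"
    using B by (simp add: ennreal_mult'[symmetric] power2_eq_square mult.assoc)
  also have "\<dots> \<le> ennreal (4 * g\<^sup>2 * B) * (\<integral>\<^sup>+s. ennreal (sqrt (p s * q s)) \<partial>\<nu>)"
    by (intro mult_left_mono B) auto
  also have "\<dots> = (\<integral>\<^sup>+s. ennreal (4 * g\<^sup>2 * B * sqrt (p s * q s)) \<partial>\<nu>)"
    using B by (simp add: nn_integral_cmult[symmetric] ennreal_mult')
  also have "\<dots> \<le> (\<integral>\<^sup>+s. ennreal ((e s - g)\<^sup>2 * p s + (e s + g)\<^sup>2 * q s)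
      + ennreal ((g * B)\<^sup>2) * (ennreal (p s) + ennreal (q s)) \<partial>\<nu>)"
    by (intro nn_integral_mono)
      (auto simp: nn ennreal_plus[symmetric] ennreal_mult'[symmetric] simp del: ennreal_plus
        intro!: ennreal_leI two_point_pointwise)
  also have "\<dots> = ?S + ennreal ((g * B)\<^sup>2) * 2"
    unfolding S by (simp add: nn_integral_add nn_integral_cmult p1 q1)
  also have "\<dots> = ?S + ennreal (2 * g\<^sup>2 * B\<^sup>2)"
  proof -
    have "ennreal ((g * B)\<^sup>2) * 2 = ennreal ((g * B)\<^sup>2 * 2)"
      by (subst ennreal_mult') auto
    then show ?thesis by (simp add: power_mult_distrib mult_ac)
  qed
  finally have *: "ennreal (4 * g\<^sup>2 * B\<^sup>2) \<le> ?S + ennreal (2 * g\<^sup>2 * B\<^sup>2)" .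
  \<comment> \<open>Subtracting the finite extra term is legitimate when the sum of the risks is
    finite; otherwise the claim is trivial.\<close>
  show ?thesis
  proof (cases ?S)
    case (real r)
    then show ?thesis using *
      by (simp add: ennreal_plus[symmetric] mult_ac del: ennreal_plus)
  qed auto
qed

text \<open>Affinities multiply over independent observations, so \<open>B\<close> becomes
  \<open>B ^ N\<close>, and the squared affinity of the two-point bound gives the exponent
  \<open>2 * N\<close>.\<close>

lemma two_point_bound_iid:
  fixes p q :: "'b \<Rightarrow> real" and g B :: real
  assumes \<mu>: "prob_space \<mu>"
    and [measurable]: "p \<in> borel_measurable \<mu>" "q \<in> borel_measurable \<mu>"
    and nn: "\<And>s. 0 \<le> p s" "\<And>s. 0 \<le> q s"
    and pp: "prob_space (density \<mu> p)" and pq: "prob_space (density \<mu> q)"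
    and B: "0 \<le> B" "ennreal B \<le> (\<integral>\<^sup>+s. ennreal (sqrt (p s * q s)) \<partial>\<mu>)"
    and e: "e \<in> borel_measurable (PiM {..<N::nat} (\<lambda>_. \<mu>))"
  shows "ennreal (2 * g\<^sup>2 * B ^ (2 * N))
    \<le> (\<integral>\<^sup>+s. ennreal ((e s - g)\<^sup>2) \<partial>PiM {..<N} (\<lambda>_. density \<mu> p))
      + (\<integral>\<^sup>+s. ennreal ((e s + g)\<^sup>2) \<partial>PiM {..<N} (\<lambda>_. density \<mu> q))"
proof -
  interpret product_sigma_finite "\<lambda>_::nat. \<mu>"
    using \<mu> by (simp add: product_sigma_finite_def prob_space_imp_sigma_finite)
  have dens: "PiM {..<N} (\<lambda>_. density \<mu> f) = density (PiM {..<N} (\<lambda>_. \<mu>)) (\<lambda>s. ennreal (\<Prod>i<N. f (s i)))"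
    if "f \<in> borel_measurable \<mu>" "\<And>s. 0 \<le> f s" "prob_space (density \<mu> f)" for f :: "'b \<Rightarrow> real"
    using that \<mu> by (subst PiM_density) (auto simp: prod_ennreal)
  have one: "(\<integral>\<^sup>+s. ennreal (\<Prod>i<N. f (s i)) \<partial>PiM {..<N} (\<lambda>_. \<mu>)) = 1"
    if [measurable]: "f \<in> borel_measurable \<mu>" and "\<And>s. 0 \<le> f s" "prob_space (density \<mu> f)" for f :: "'b \<Rightarrow> real"
  proof -
    have "(\<integral>\<^sup>+s. ennreal (f s) \<partial>\<mu>) = emeasure (density \<mu> f) (space (density \<mu> f))"
      by (simp add: emeasure_density cong: nn_integral_cong)
    also have "\<dots> = 1" using that by (intro prob_space.emeasure_space_1)
    finally show ?thesis
      using that by (simp add: prod_ennreal[symmetric] product_nn_integral_prod[of _ "\<lambda>_ x. ennreal (f x)"])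
  qed
  have sqrt_prod: "sqrt (\<Prod>i<N. f i) = (\<Prod>i<N. sqrt (f i))" for f :: "nat \<Rightarrow> real"
    by (induction N) (auto simp: real_sqrt_mult)
  have aff: "ennreal (B ^ N) \<le> (\<integral>\<^sup>+s. ennreal (sqrt ((\<Prod>i<N. p (s i)) * (\<Prod>i<N. q (s i)))) \<partial>PiM {..<N} (\<lambda>_. \<mu>))"
  proof -
    have "ennreal (B ^ N) = ennreal B ^ N" using B by (simp add: ennreal_power)
    also have "\<dots> \<le> (\<integral>\<^sup>+s. ennreal (sqrt (p s * q s)) \<partial>\<mu>) ^ N"
      using B by (intro power_mono) auto
    also have "\<dots> = (\<integral>\<^sup>+s. (\<Prod>i<N. ennreal (sqrt (p (s i) * q (s i)))) \<partial>PiM {..<N} (\<lambda>_. \<mu>))"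
      by (subst product_nn_integral_prod) auto
    also have "\<dots> = (\<integral>\<^sup>+s. ennreal (sqrt ((\<Prod>i<N. p (s i)) * (\<Prod>i<N. q (s i)))) \<partial>PiM {..<N} (\<lambda>_. \<mu>))"
      by (intro nn_integral_cong)
        (simp add: prod_ennreal nn prod.distrib[symmetric] sqrt_prod)
    finally show ?thesis .
  qed
  show ?thesis
    unfolding dens[OF assms(2) nn(1) pp] dens[OF assms(3) nn(2) pq]
    using two_point_bound[of e "PiM {..<N} (\<lambda>_. \<mu>)" "\<lambda>s. \<Prod>i<N. p (s i)" "\<lambda>s. \<Prod>i<N. q (s i)" "B ^ N" g]
      e one[OF assms(2) nn(1) pp] one[OF assms(3) nn(2) pq] aff B nn
    by (simp add: prod_nonneg power_mult[symmetric] mult.commute[of N])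
qed

section \<open>Two-point label laws and their privatisation\<close>

text \<open>Given \<open>x\<close>, the label is \<open>\<tau>\<close> or \<open>-\<tau>\<close>
  with probabilities \<open>(1 + u x) / 2\<close> and \<open>(1 - u x) / 2\<close>, so the
  regression function is \<open>\<tau> * u x\<close>. This needs \<open>u\<close> to be bounded by 1
  in absolute value. The \<open>distr\<close> along \<open>id\<close> moves the discrete measure to
  the Borel sets of the reals.\<close>

definition two_point_law :: "'a::euclidean_space measure \<Rightarrow> real \<Rightarrow> ('a \<Rightarrow> real) \<Rightarrow> ('a \<times> real) measure" where
  "two_point_law \<Lambda> \<tau> u =
     density (\<Lambda> \<Otimes>\<^sub>M distr (measure_pmf (pmf_of_set {\<tau>, -\<tau>})) borel id) (\<lambda>(x, y). ennreal (1 + u x * y / \<tau>))"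

lemma sets_two_point_law [simp]:
  "sets \<Lambda> = sets borel \<Longrightarrow> sets (two_point_law \<Lambda> \<tau> u) = sets borel"
  by (simp add: two_point_law_def borel_prod[symmetric] cong: sets_pair_measure_cong)

text \<open>Integrates out the label. All later facts about the law (marginal, null sets,
  expectations, risk) are derived from this formula.\<close>

lemma nn_integral_two_point_law:
  fixes \<Lambda> :: "'a::euclidean_space measure"
  assumes sets [measurable_cong]: "sets \<Lambda> = sets borel" and \<tau>: "0 < \<tau>"
    and [measurable]: "u \<in> borel_measurable borel" and u: "\<And>x. \<bar>u x\<bar> \<le> 1"
    and \<phi>: "\<phi> \<in> borel_measurable borel"
  shows "(\<integral>\<^sup>+p. \<phi> p \<partial>two_point_law \<Lambda> \<tau> u) =
    (\<integral>\<^sup>+x. ennreal ((1 + u x) / 2) * \<phi> (x, \<tau>) + ennreal ((1 - u x) / 2) * \<phi> (x, -\<tau>) \<partial>\<Lambda>)"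
proof -
  define K where "K = distr (measure_pmf (pmf_of_set {\<tau>, -\<tau>})) borel id"
  have setsK [measurable_cong]: "sets K = sets borel" by (simp add: K_def)
  have [measurable]: "\<phi> \<in> borel_measurable (borel \<Otimes>\<^sub>M borel)" using \<phi> by (simp add: borel_prod)
  interpret K: prob_space K unfolding K_def by (rule prob_space.prob_space_distr) (auto intro: prob_space_measure_pmf)
  have half: "ennreal (1 + t) * c / 2 = ennreal ((1 + t) / 2) * c" if "\<bar>t\<bar> \<le> 1" for t c
  proof -
    have "ennreal ((1 + t) / 2) = ennreal (1 + t) / 2"
      using that by (subst divide_ennreal[symmetric]) auto
    then show ?thesis by (simp add: divide_ennreal_def mult_ac)
  qed
  have inner: "(\<integral>\<^sup>+y. ennreal (1 + u x * y / \<tau>) * \<phi> (x, y) \<partial>K)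
     = ennreal ((1 + u x) / 2) * \<phi> (x, \<tau>) + ennreal ((1 - u x) / 2) * \<phi> (x, -\<tau>)" for x
    using \<tau> half[of "u x"] half[of "- u x"] u[of x]
    by (simp add: K_def nn_integral_distr nn_integral_pmf_of_set add_divide_distrib_ennreal)
  have "(\<integral>\<^sup>+p. \<phi> p \<partial>two_point_law \<Lambda> \<tau> u) = (\<integral>\<^sup>+(x, y). ennreal (1 + u x * y / \<tau>) * \<phi> (x, y) \<partial>(\<Lambda> \<Otimes>\<^sub>M K))"
    unfolding two_point_law_def K_def[symmetric]
    by (subst nn_integral_density) (auto simp: case_prod_unfold)
  also have "\<dots> = (\<integral>\<^sup>+x. \<integral>\<^sup>+y. ennreal (1 + u x * y / \<tau>) * \<phi> (x, y) \<partial>K \<partial>\<Lambda>)"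
    by (subst K.nn_integral_fst[symmetric]) auto
  finally show ?thesis by (simp add: inner)
qed

text \<open>The hypothesis is tested on the set where \<open>g < f\<close>. There the excess
  \<open>f - g\<close> is positive but has integral 0; finiteness of the integral of
  \<open>g\<close> is what permits the subtraction.\<close>

lemma density_le_imp_AE_le:
  assumes [measurable]: "f \<in> borel_measurable M" "g \<in> borel_measurable M"
    and g: "(\<integral>\<^sup>+x. g x \<partial>M) < \<infinity>"
    and le: "\<And>S. S \<in> sets M \<Longrightarrow> (\<integral>\<^sup>+x. f x * indicator S x \<partial>M) \<le> (\<integral>\<^sup>+x. g x * indicator S x \<partial>M)"
  shows "AE x in M. f x \<le> (g x :: ennreal)"
proof -
  define S where "S = {x \<in> space M. g x < f x}"
  have [measurable]: "S \<in> sets M" unfolding S_def by measurable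
  have gS: "(\<integral>\<^sup>+x. g x * indicator S x \<partial>M) \<noteq> \<infinity>"
  proof -
    have "(\<integral>\<^sup>+x. g x * indicator S x \<partial>M) \<le> (\<integral>\<^sup>+x. g x \<partial>M)"
      by (intro nn_integral_mono) (auto simp: indicator_def)
    then show ?thesis using g by auto
  qed
  have "(\<integral>\<^sup>+x. (f x - g x) * indicator S x \<partial>M) = (\<integral>\<^sup>+x. f x * indicator S x - g x * indicator S x \<partial>M)"
    by (intro nn_integral_cong) (auto simp: indicator_def)
  also have "\<dots> = (\<integral>\<^sup>+x. f x * indicator S x \<partial>M) - (\<integral>\<^sup>+x. g x * indicator S x \<partial>M)"
    using gS by (intro nn_integral_diff) (auto simp: S_def indicator_def)
  also have "\<dots> = 0" using le[of S] gS by (auto simp: diff_eq_0_iff_ennreal top.not_eq_extremum intro: le_less_trans)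
  finally have "AE x in M. (f x - g x) * indicator S x = 0"
    by (subst (asm) nn_integral_0_iff_AE) auto
  then show ?thesis
  proof (rule AE_mp, intro AE_I2 impI)
    fix x assume "x \<in> space M" "(f x - g x) * indicator S x = 0"
    then show "f x \<le> g x"
      by (auto simp: S_def indicator_def split: if_splits) (metis diff_eq_0_iff_ennreal leD linorder_not_less)
  qed
qed

text \<open>Relative to their average, two measures within a factor \<open>exp \<epsilon>\<close> of each other have
  densities \<open>1 + b\<close> and \<open>1 - b\<close>, where \<open>b = (r - 1) / (r + 1)\<close> for their density ratio \<open>r\<close>.\<close>

lemma ratio_bounded_measures:
  fixes P Q :: "'b measure" and \<epsilon> :: real
  assumes P: "prob_space P" and Q: "prob_space Q" and sets: "sets P = sets Q" and \<epsilon>: "0 < \<epsilon>"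
    and PQ: "\<And>S. S \<in> sets Q \<Longrightarrow> emeasure P S \<le> ennreal (exp \<epsilon>) * emeasure Q S"
    and QP: "\<And>S. S \<in> sets Q \<Longrightarrow> emeasure Q S \<le> ennreal (exp \<epsilon>) * emeasure P S"
  obtains \<mu> b where "prob_space \<mu>" "sets \<mu> = sets Q" "b \<in> borel_measurable Q"
    "\<And>z. \<bar>b z\<bar> \<le> min \<epsilon> (1::real)"
    "P = density \<mu> (\<lambda>z. ennreal (1 + b z))" "Q = density \<mu> (\<lambda>z. ennreal (1 - b z))"
proof -
  interpret P: prob_space P by fact
  interpret Q: prob_space Q by fact
  have "absolutely_continuous Q P"
    unfolding absolutely_continuous_def null_sets_def using PQ sets by fastforce
  then obtain r0 where r0 [measurable]: "r0 \<in> borel_measurable Q" and Pr0: "density Q r0 = P"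
    using Q.Radon_Nikodym_finite_measure[OF P.finite_measure_axioms sets] by blast
  \<comment> \<open>The Radon-Nikodym derivative obeys the ratio bounds only almost everywhere.
    Clamping it to the interval makes them, and hence the bound on \<open>b\<close>, hold at every
    point.\<close>
  define r where "r z = max (exp (-\<epsilon>)) (min (exp \<epsilon>) (enn2real (r0 z)))" for z
  have [measurable]: "r \<in> borel_measurable Q" unfolding r_def by measurable
  have r: "exp (-\<epsilon>) \<le> r z" "r z \<le> exp \<epsilon>" "0 < r z" for z
    using \<epsilon> by (auto simp: r_def less_max_iff_disj)
  have dP: "(\<integral>\<^sup>+z. r0 z * indicator S z \<partial>Q) = emeasure P S" if "S \<in> sets Q" for S
    using that by (subst Pr0[symmetric]) (simp add: emeasure_density)
  have up: "AE z in Q. r0 z \<le> ennreal (exp \<epsilon>)"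
    using PQ dP
    by (intro density_le_imp_AE_le) (auto simp: nn_integral_cmult_indicator Q.emeasure_space_1)
  have "(\<integral>\<^sup>+z. ennreal (exp \<epsilon>) * r0 z \<partial>Q) = ennreal (exp \<epsilon>) * emeasure P (space Q)"
    using dP[of "space Q"] by (simp add: nn_integral_cmult cong: nn_integral_cong)
  then have "(\<integral>\<^sup>+z. ennreal (exp \<epsilon>) * r0 z \<partial>Q) < \<infinity>"
    using sets_eq_imp_space_eq[OF sets] P.emeasure_space_1 by simp
  \<comment> \<open>The lower bound on the derivative is stated in multiplied form, so that both
    sides are densities and no division in \<open>ennreal\<close> occurs.\<close>
  then have low: "AE z in Q. 1 \<le> ennreal (exp \<epsilon>) * r0 z"
    using QP dP
    by (intro density_le_imp_AE_le) (auto simp: nn_integral_cmult mult.assoc)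
  have "AE z in Q. r0 z = ennreal (r z)"
    using up low
  proof eventually_elim
    case (elim z)
    obtain t where t: "0 \<le> t" "r0 z = ennreal t" using elim(1) by (cases "r0 z") (auto simp: top_unique)
    have "t \<le> exp \<epsilon>" using elim(1) t by simp
    moreover have "exp (-\<epsilon>) \<le> t"
    proof -
      have "1 \<le> ennreal (exp \<epsilon> * t)" using elim(2) t by (simp add: ennreal_mult')
      then have "1 \<le> exp \<epsilon> * t" by simp
      then show ?thesis by (simp add: exp_minus field_simps)
    qed
    ultimately show ?case using t by (simp add: r_def)
  qed
  then have Pr: "P = density Q (\<lambda>z. ennreal (r z))"
    by (subst Pr0[symmetric], intro density_cong) auto
  define \<mu> where "\<mu> = density Q (\<lambda>z. ennreal ((1 + r z) / 2))"
  define b where "b z = (r z - 1) / (r z + 1)" for z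
  have [measurable]: "b \<in> borel_measurable Q" unfolding b_def by measurable
  have b: "\<bar>b z\<bar> \<le> min \<epsilon> 1" for z
  proof -
    \<comment> \<open>Both cases below bound \<open>\<bar>b z\<bar>\<close> by
      \<open>1 - exp (-\<epsilon>)\<close>, which stays linear in \<epsilon>; the cruder
      \<open>exp \<epsilon> - 1\<close> would not give the bound by \<epsilon>.\<close>
    have e: "1 - exp (-\<epsilon>) \<le> \<epsilon>" using exp_ge_add_one_self[of "-\<epsilon>"] by linarith
    have "\<bar>b z\<bar> \<le> \<epsilon>"
    proof (cases "r z \<ge> 1")
      case True
      have "\<bar>b z\<bar> = (r z - 1) / (r z + 1)" using True by (simp add: b_def)
      also have "\<dots> \<le> (r z - 1) / r z" using True by (intro divide_left_mono) auto
      also have "\<dots> = 1 - 1 / r z" using r(3)[of z] by (simp add: field_simps)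
      also have "\<dots> \<le> 1 - exp (-\<epsilon>)" using r(2,3)[of z] by (simp add: exp_minus field_simps)
      finally show ?thesis using e by linarith
    next
      case False
      have "\<bar>b z\<bar> = (1 - r z) / (r z + 1)" using False r(3)[of z] by (simp add: b_def abs_if divide_simps)
      also have "\<dots> \<le> (1 - r z) / 1" using False r(3)[of z] by (intro divide_left_mono) auto
      finally show ?thesis using e r(1)[of z] by simp
    qed
    moreover have "\<bar>b z\<bar> \<le> 1" using r(3)[of z] by (simp add: b_def abs_le_iff divide_simps)
    ultimately show ?thesis by simp
  qed
  have dens: "density \<mu> (\<lambda>z. ennreal (w z)) = density Q (\<lambda>z. ennreal ((1 + r z) / 2 * w z))"
    if [measurable]: "w \<in> borel_measurable Q" for w
    unfolding \<mu>_def using r(3)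
    by (subst density_density_eq) (auto simp: ennreal_mult'[symmetric] less_imp_le add_nonneg_nonneg)
  have "(1 + r z) / 2 * (1 + b z) = r z" "(1 + r z) / 2 * (1 - b z) = 1" for z
    using r(3)[of z] by (auto simp: b_def field_simps)
  then have Pb: "P = density \<mu> (\<lambda>z. ennreal (1 + b z))" and Qb: "Q = density \<mu> (\<lambda>z. ennreal (1 - b z))"
    by (auto simp: dens Pr[symmetric] density_1)
  have "emeasure \<mu> (space \<mu>) = 1"
  proof -
    have half: "ennreal ((1 + r z) / 2) = ennreal (1/2) * (1 + ennreal (r z))" for z
    proof -
      have "ennreal ((1 + r z) / 2) = ennreal (1/2 * (1 + r z))" by simp
      also have "\<dots> = ennreal (1/2) * ennreal (1 + r z)" by (rule ennreal_mult') simp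
      also have "ennreal (1 + r z) = 1 + ennreal (r z)" using r(3)[of z] by (subst ennreal_plus) auto
      finally show ?thesis .
    qed
    have "emeasure \<mu> (space \<mu>) = (\<integral>\<^sup>+z. ennreal (1/2) * (1 + ennreal (r z)) \<partial>Q)"
      unfolding \<mu>_def by (simp add: emeasure_density half cong: nn_integral_cong)
    also have "\<dots> = ennreal (1/2) * (1 + emeasure P (space Q))"
      by (subst Pr) (simp add: nn_integral_cmult nn_integral_add Q.emeasure_space_1 emeasure_density cong: nn_integral_cong)
    also have "\<dots> = ennreal (1/2) * ennreal 2"
      using sets_eq_imp_space_eq[OF sets] P.emeasure_space_1 by simp
    also have "\<dots> = 1" by (subst ennreal_mult'[symmetric]) auto
    finally show ?thesis .
  qed
  then have "prob_space \<mu>" by (rule prob_spaceI)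
  moreover have "sets \<mu> = sets Q" by (simp add: \<mu>_def)
  ultimately show ?thesis using b Pb Qb \<open>b \<in> borel_measurable Q\<close> by (intro that[of \<mu> b])
qed

section \<open>The law of one privatised observation\<close>

lemma label_LDP_emeasure_le:
  assumes "label_LDP \<epsilon> Zs M" "S \<in> sets Zs"
  shows "emeasure (M (x, y)) S \<le> ennreal (exp \<epsilon>) * emeasure (M (x, y')) S"
proof -
  have p: "M p \<in> space (prob_algebra Zs)" for p
    using assms unfolding label_LDP_def by (auto dest: measurable_space[of M borel _ p])
  then have "prob_space (M p)" for p by (auto simp: space_prob_algebra)
  then have "emeasure (M p) S = ennreal (measure (M p) S)" for p
    by (intro finite_measure.emeasure_eq_measure) (simp add: prob_space.finite_measure)
  then show ?thesis
    using assms by (auto simp: label_LDP_def ennreal_mult'[symmetric] intro!: ennreal_leI)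
qed

text \<open>The privatised law is the mixture of the two constant-label laws with weights depending
  on \<open>x\<close>. The essential point is that \<open>\<mu>\<close> and \<open>b\<close> are
  obtained before \<open>u\<close>: one pair serves all sign patterns, so the laws are compared
  through densities with respect to a common measure.\<close>

lemma priv_law_two_point_law:
  fixes \<Lambda> :: "'a::euclidean_space measure" and Zs :: "'z measure"
  assumes M: "label_LDP \<epsilon> Zs M" and \<epsilon>: "0 < \<epsilon>" and \<tau>: "0 < \<tau>"
    and \<Lambda>: "prob_space \<Lambda>" and sets [measurable_cong]: "sets \<Lambda> = sets borel"
  obtains \<mu> b where "prob_space \<mu>" "sets \<mu> = sets (borel \<Otimes>\<^sub>M Zs)" "b \<in> borel_measurable (borel \<Otimes>\<^sub>M Zs)"
    "\<And>s. \<bar>b s\<bar> \<le> min \<epsilon> (1::real)"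
    "\<And>B. B \<in> sets borel \<Longrightarrow> emeasure \<mu> (B \<times> space Zs) = emeasure \<Lambda> B"
    "\<And>u. u \<in> borel_measurable borel \<Longrightarrow> (\<And>x. \<bar>u x\<bar> \<le> 1) \<Longrightarrow>
       priv_law (two_point_law \<Lambda> \<tau> u) Zs M = density \<mu> (\<lambda>s. ennreal (1 + u (fst s) * b s))"
proof -
  interpret \<Lambda>: prob_space \<Lambda> by fact
  have spL: "space \<Lambda> = UNIV" using sets_eq_imp_space_eq[OF sets] by simp
  have Mp: "M \<in> borel \<rightarrow>\<^sub>M prob_algebra Zs" using M by (simp add: label_LDP_def)
  have [measurable]: "M \<in> borel \<Otimes>\<^sub>M borel \<rightarrow>\<^sub>M subprob_algebra Zs"
    using measurable_prob_algebraD[OF Mp] by (simp add: borel_prod)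
  have M1: "prob_space (M p)" "sets (M p) = sets Zs" for p
    using measurable_space[OF Mp, of p] by (auto simp: space_prob_algebra)
  have PairM [measurable]: "Pair a \<in> M p \<rightarrow>\<^sub>M borel \<Otimes>\<^sub>M Zs" for a :: 'a and p
    unfolding measurable_cong_sets[OF M1(2) refl] by simp
  have spM: "space (M p) = space Zs" for p using sets_eq_imp_space_eq[OF M1(2)] .
  define K where "K p = distr (M p) (borel \<Otimes>\<^sub>M Zs) (\<lambda>z. (fst p, z))" for p :: "'a \<times> real"
  have K [measurable]: "K \<in> borel \<Otimes>\<^sub>M borel \<rightarrow>\<^sub>M subprob_algebra (borel \<Otimes>\<^sub>M Zs)"
    unfolding K_def by (rule measurable_distr2[where M=Zs]) measurable
  have KI: "(\<integral>\<^sup>+s. \<phi> s \<partial>K p) = (\<integral>\<^sup>+z. \<phi> (fst p, z) \<partial>M p)"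
    if [measurable]: "\<phi> \<in> borel_measurable (borel \<Otimes>\<^sub>M Zs)" for \<phi> p
    unfolding K_def by (subst nn_integral_distr) auto
  \<comment> \<open>The joint law of covariate and private output when every label equals
    \<open>y\<close>.\<close>
  define A where "A y = \<Lambda> \<bind> (\<lambda>x. K (x, y))" for y
  have setsA [measurable_cong]: "sets (A y) = sets (borel \<Otimes>\<^sub>M Zs)" for y
    unfolding A_def by (rule sets_bind) (auto simp: K_def spL)
  have AI: "(\<integral>\<^sup>+s. \<phi> s \<partial>A y) = (\<integral>\<^sup>+x. \<integral>\<^sup>+s. \<phi> s \<partial>K (x, y) \<partial>\<Lambda>)"
    if [measurable]: "\<phi> \<in> borel_measurable (borel \<Otimes>\<^sub>M Zs)" for \<phi> y
    unfolding A_def by (rule nn_integral_bind) measurable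
  have Ae: "emeasure (A y) S = (\<integral>\<^sup>+x. emeasure (M (x, y)) {z \<in> space Zs. (x, z) \<in> S} \<partial>\<Lambda>)"
    if [measurable]: "S \<in> sets (borel \<Otimes>\<^sub>M Zs)" for y S
  proof -
    have "emeasure (A y) S = (\<integral>\<^sup>+x. emeasure (K (x, y)) S \<partial>\<Lambda>)"
      unfolding A_def by (rule emeasure_bind[OF _ _ that]) (simp_all add: spL)
    also have "\<dots> = (\<integral>\<^sup>+x. emeasure (M (x, y)) {z \<in> space Zs. (x, z) \<in> S} \<partial>\<Lambda>)"
      by (intro nn_integral_cong) (auto simp: K_def emeasure_distr spM vimage_def Int_def intro!: arg_cong2[where f=emeasure])
    finally show ?thesis .
  qed
  have marg: "emeasure (A y) (B \<times> space Zs) = emeasure \<Lambda> B" if [measurable]: "B \<in> sets borel" for B y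
  proof -
    have "emeasure (A y) (B \<times> space Zs) = (\<integral>\<^sup>+x. indicator B x \<partial>\<Lambda>)"
      unfolding Ae[OF pair_measureI[OF that sets.top]]
      using prob_space.emeasure_space_1[OF M1(1)]
      by (intro nn_integral_cong) (auto simp: indicator_def spM)
    then show ?thesis by simp
  qed
  have pA: "prob_space (A y)" for y
  proof (rule prob_spaceI)
    have "space (A y) = UNIV \<times> space Zs"
      using sets_eq_imp_space_eq[OF setsA] by (simp add: space_pair_measure)
    then show "emeasure (A y) (space (A y)) = 1"
      using marg[of UNIV y] \<Lambda>.emeasure_space_1 by (simp add: spL)
  qed
  \<comment> \<open>Privacy holds conditionally on each \<open>x\<close>; integrating over the
    slices of \<open>S\<close> carries the same factor to the joint laws, which share their
    covariate marginal.\<close>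
  have le: "emeasure (A y) S \<le> ennreal (exp \<epsilon>) * emeasure (A y') S" if S [measurable]: "S \<in> sets (borel \<Otimes>\<^sub>M Zs)" for y y' S
  proof -
    have [measurable]: "(\<lambda>x. emeasure (M (x, y')) {z \<in> space Zs. (x, z) \<in> S}) \<in> borel_measurable \<Lambda>"
    proof (rule emeasure_measurable_subprob_algebra2[where N=Zs])
      have "(SIGMA x:space \<Lambda>. {z \<in> space Zs. (x, z) \<in> S}) = S"
        using sets.sets_into_space[OF S] by (auto simp: spL space_pair_measure)
      then show "(SIGMA x:space \<Lambda>. {z \<in> space Zs. (x, z) \<in> S}) \<in> sets (\<Lambda> \<Otimes>\<^sub>M Zs)"
        using S sets_pair_measure_cong[OF sets refl, of Zs] by simp
    qed measurable
    show ?thesis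
      unfolding Ae[OF S]
      by (subst nn_integral_cmult[symmetric]) (auto intro!: nn_integral_mono label_LDP_emeasure_le[OF M])
  qed
  have le1: "emeasure (A \<tau>) S \<le> ennreal (exp \<epsilon>) * emeasure (A (-\<tau>)) S"
    and le2: "emeasure (A (-\<tau>)) S \<le> ennreal (exp \<epsilon>) * emeasure (A \<tau>) S" if "S \<in> sets (A (-\<tau>))" for S
    using that by (auto simp: setsA intro: le)
  obtain \<mu> b where \<mu>: "prob_space \<mu>" "sets \<mu> = sets (A (-\<tau>))" "b \<in> borel_measurable (A (-\<tau>))"
    "\<And>s. \<bar>b s\<bar> \<le> min \<epsilon> (1::real)"
    "A \<tau> = density \<mu> (\<lambda>s. ennreal (1 + b s))" "A (-\<tau>) = density \<mu> (\<lambda>s. ennreal (1 - b s))"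
    by (rule ratio_bounded_measures[OF pA pA trans[OF setsA setsA[symmetric]] \<epsilon> le1 le2])
      (assumption | rule that | blast)+
  have sets\<mu> [measurable_cong]: "sets \<mu> = sets (borel \<Otimes>\<^sub>M Zs)" using \<mu>(2) by (simp add: setsA)
  have [measurable]: "b \<in> borel_measurable (borel \<Otimes>\<^sub>M Zs)"
    using \<mu>(3) by (simp add: measurable_cong_sets[OF setsA refl])
  have b1: "\<bar>b s\<bar> \<le> 1" for s using \<mu>(4)[of s] by simp
  show thesis
  proof (rule that[of \<mu> b])
    fix B :: "'a set" assume [measurable]: "B \<in> sets borel"
    \<comment> \<open>\<open>\<mu>\<close> is the average of the two constant-label laws, both of
      which have covariate marginal \<open>\<Lambda>\<close>.\<close>
    have "2 * emeasure \<Lambda> B = emeasure (A \<tau>) (B \<times> space Zs) + emeasure (A (-\<tau>)) (B \<times> space Zs)"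
      by (simp add: marg mult_2)
    also have "\<dots> = (\<integral>\<^sup>+s. ennreal (1 + b s) * indicator (B \<times> space Zs) s + ennreal (1 - b s) * indicator (B \<times> space Zs) s \<partial>\<mu>)"
      unfolding \<mu>(5,6) by (subst nn_integral_add) (auto simp: emeasure_density)
    also have "\<dots> = (\<integral>\<^sup>+s. 2 * indicator (B \<times> space Zs) s \<partial>\<mu>)"
    proof (intro nn_integral_cong)
      fix s
      have "ennreal (1 + b s) + ennreal (1 - b s) = 2"
        using b1[of s] by (subst ennreal_plus[symmetric]) auto
      then show "ennreal (1 + b s) * indicator (B \<times> space Zs) s + ennreal (1 - b s) * indicator (B \<times> space Zs) s
         = 2 * indicator (B \<times> space Zs) s" by (simp add: distrib_right[symmetric])
    qed
    also have "\<dots> = 2 * emeasure \<mu> (B \<times> space Zs)"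
      by (subst nn_integral_cmult) auto
    finally show "emeasure \<mu> (B \<times> space Zs) = emeasure \<Lambda> B"
      by (simp add: ennreal_mult_cancel_left)
  next
    fix u :: "'a \<Rightarrow> real" assume [measurable]: "u \<in> borel_measurable borel" and u: "\<And>x. \<bar>u x\<bar> \<le> 1"
    let ?P = "two_point_law \<Lambda> \<tau> u"
    have setsP: "sets ?P = sets (borel \<Otimes>\<^sub>M borel)" unfolding borel_prod by (rule sets_two_point_law[OF sets])
    have KP: "K \<in> ?P \<rightarrow>\<^sub>M subprob_algebra (borel \<Otimes>\<^sub>M Zs)"
      using K by (simp add: measurable_cong_sets[OF setsP refl])
    have pl: "priv_law ?P Zs M = ?P \<bind> K" unfolding priv_law_def K_def ..
    have spP: "space ?P \<noteq> {}" using sets_eq_imp_space_eq[OF setsP] by (simp add: space_pair_measure)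
    show "priv_law ?P Zs M = density \<mu> (\<lambda>s. ennreal (1 + u (fst s) * b s))"
    proof (rule measure_eqI)
      show "sets (priv_law ?P Zs M) = sets (density \<mu> (\<lambda>s. ennreal (1 + u (fst s) * b s)))"
        unfolding pl using sets_bind[OF sets_kernel[OF KP] spP] by (simp add: sets\<mu>)
    next
      fix S assume "S \<in> sets (priv_law ?P Zs M)"
      then have S [measurable]: "S \<in> sets (borel \<Otimes>\<^sub>M Zs)"
        unfolding pl using sets_bind[OF sets_kernel[OF KP] spP] by simp
      have KS [measurable]: "(\<lambda>p. emeasure (K p) S) \<in> borel_measurable (borel \<Otimes>\<^sub>M borel)"
        by measurable
      have w: "(\<integral>\<^sup>+x. ennreal (v x) * emeasure (K (x, y)) S \<partial>\<Lambda>) = (\<integral>\<^sup>+s. ennreal (v (fst s)) * indicator S s \<partial>A y)"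
        if [measurable]: "v \<in> borel_measurable borel" for v y
      proof -
        have "(\<integral>\<^sup>+s. ennreal (v (fst s)) * indicator S s \<partial>A y)
            = (\<integral>\<^sup>+x. \<integral>\<^sup>+s. ennreal (v (fst s)) * indicator S s \<partial>K (x, y) \<partial>\<Lambda>)"
          by (rule AI) measurable
        also have "\<dots> = (\<integral>\<^sup>+x. ennreal (v x) * (\<integral>\<^sup>+s. indicator S s \<partial>K (x, y)) \<partial>\<Lambda>)"
          by (intro nn_integral_cong) (simp add: KI nn_integral_cmult)
        finally show ?thesis by (simp add: K_def)
      qed
      have "emeasure (priv_law ?P Zs M) S = (\<integral>\<^sup>+p. emeasure (K p) S \<partial>?P)"
        unfolding pl by (rule emeasure_bind[OF spP KP S])
      also have "\<dots> = (\<integral>\<^sup>+x. ennreal ((1 + u x) / 2) * emeasure (K (x, \<tau>)) S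
          + ennreal ((1 - u x) / 2) * emeasure (K (x, -\<tau>)) S \<partial>\<Lambda>)"
        using KS by (intro nn_integral_two_point_law[OF sets \<tau> _ u]) (auto simp: borel_prod)
      also have "\<dots> = (\<integral>\<^sup>+s. ennreal ((1 + u (fst s)) / 2) * indicator S s \<partial>A \<tau>)
          + (\<integral>\<^sup>+s. ennreal ((1 - u (fst s)) / 2) * indicator S s \<partial>A (-\<tau>))"
        by (subst nn_integral_add) (auto simp: w)
      also have "\<dots> = (\<integral>\<^sup>+s. ennreal (1 + b s) * (ennreal ((1 + u (fst s)) / 2) * indicator S s)
          + ennreal (1 - b s) * (ennreal ((1 - u (fst s)) / 2) * indicator S s) \<partial>\<mu>)"
        unfolding \<mu>(5,6) by (simp add: nn_integral_density nn_integral_add)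
      also have "\<dots> = (\<integral>\<^sup>+s. ennreal (1 + u (fst s) * b s) * indicator S s \<partial>\<mu>)"
      proof (intro nn_integral_cong)
        fix s
        have nn: "0 \<le> 1 + b s" "0 \<le> 1 - b s" "0 \<le> (1 + u (fst s)) / 2" "0 \<le> (1 - u (fst s)) / 2"
          using b1[of s] u[of "fst s"] by auto
        have "ennreal (1 + b s) * ennreal ((1 + u (fst s)) / 2) + ennreal (1 - b s) * ennreal ((1 - u (fst s)) / 2)
          = ennreal ((1 + b s) * ((1 + u (fst s)) / 2) + (1 - b s) * ((1 - u (fst s)) / 2))"
          using nn by (simp only: ennreal_mult[symmetric] ennreal_plus[symmetric] mult_nonneg_nonneg)
        \<comment> \<open>The constant-label densities \<open>1 + b\<close> and
          \<open>1 - b\<close>, weighted by the label probabilities, combine so that only the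
          product of \<open>u\<close> and \<open>b\<close> remains.\<close>
        also have "(1 + b s) * ((1 + u (fst s)) / 2) + (1 - b s) * ((1 - u (fst s)) / 2) = 1 + u (fst s) * b s"
          by (simp add: field_simps)
        finally show "ennreal (1 + b s) * (ennreal ((1 + u (fst s)) / 2) * indicator S s)
          + ennreal (1 - b s) * (ennreal ((1 - u (fst s)) / 2) * indicator S s)
          = ennreal (1 + u (fst s) * b s) * indicator S s"
          by (simp add: mult.assoc[symmetric] distrib_right[symmetric])
      qed
      also have "\<dots> = emeasure (density \<mu> (\<lambda>s. ennreal (1 + u (fst s) * b s))) S"
        by (simp add: emeasure_density)
      finally show "emeasure (priv_law ?P Zs M) S = \<dots>" .
    qed
  qed (use \<mu>(1,4) sets\<mu> in auto)
qed

section \<open>Excess risk\<close>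

context
  fixes \<Lambda> :: "'a::euclidean_space measure" and \<tau> :: real and u :: "'a \<Rightarrow> real"
  assumes \<Lambda>: "prob_space \<Lambda>" and sets\<Lambda> [measurable_cong]: "sets \<Lambda> = sets borel" and \<tau>: "0 < \<tau>"
    and u_meas [measurable]: "u \<in> borel_measurable borel" and u: "\<And>x. \<bar>u x\<bar> \<le> 1"
begin

lemma two_point_weights_sum: "ennreal ((1 + u x) / 2) + ennreal ((1 - u x) / 2) = 1"
  using u[of x] by (simp add: ennreal_plus[symmetric] add_divide_distrib[symmetric] del: ennreal_plus)

lemma nn_integral_two_point_law_fst:
  assumes [measurable]: "f \<in> borel_measurable borel"
  shows "(\<integral>\<^sup>+p. f (fst p) \<partial>two_point_law \<Lambda> \<tau> u) = (\<integral>\<^sup>+x. f x \<partial>\<Lambda>)"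
proof -
  have [measurable]: "(fst :: 'a \<times> real \<Rightarrow> 'a) \<in> borel_measurable borel"
    by (intro borel_measurable_continuous_onI continuous_intros)
  show ?thesis
    by (subst nn_integral_two_point_law[OF sets\<Lambda> \<tau> u_meas u])
      (simp_all add: distrib_right[symmetric] two_point_weights_sum)
qed

lemma prob_space_two_point_law: "prob_space (two_point_law \<Lambda> \<tau> u)"
  using nn_integral_two_point_law_fst[of "\<lambda>_. 1"] prob_space.emeasure_space_1[OF \<Lambda>]
  by (intro prob_spaceI) simp

lemma distr_fst_two_point_law: "distr (two_point_law \<Lambda> \<tau> u) borel fst = \<Lambda>"
proof (rule measure_eqI)
  fix B assume "B \<in> sets (distr (two_point_law \<Lambda> \<tau> u) borel fst)"
  then have [measurable]: "B \<in> sets borel" by simp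
  have [measurable]: "fst \<in> two_point_law \<Lambda> \<tau> u \<rightarrow>\<^sub>M borel"
    unfolding measurable_cong_sets[OF sets_two_point_law[OF sets\<Lambda>] refl]
    by (intro borel_measurable_continuous_onI continuous_intros)
  have "emeasure (distr (two_point_law \<Lambda> \<tau> u) borel fst) B
      = (\<integral>\<^sup>+x. indicator B x \<partial>distr (two_point_law \<Lambda> \<tau> u) borel fst)" by simp
  also have "\<dots> = (\<integral>\<^sup>+p. indicator B (fst p) \<partial>two_point_law \<Lambda> \<tau> u)"
    by (subst nn_integral_distr) auto
  also have "\<dots> = emeasure \<Lambda> B" by (subst nn_integral_two_point_law_fst) auto
  finally show "emeasure (distr (two_point_law \<Lambda> \<tau> u) borel fst) B = emeasure \<Lambda> B" .
qed (simp add: sets\<Lambda>)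

text \<open>The law is carried by the labels \<open>\<tau>\<close> and \<open>-\<tau>\<close>, so a
  property has to be checked only there.\<close>

lemma AE_two_point_law:
  assumes [measurable]: "Measurable.pred borel Q" and Q: "\<And>x. Q (x, \<tau>)" "\<And>x. Q (x, -\<tau>)"
  shows "AE p in two_point_law \<Lambda> \<tau> u. Q p"
proof (rule AE_I')
  have "emeasure (two_point_law \<Lambda> \<tau> u) {p. \<not> Q p} = (\<integral>\<^sup>+p. indicator {p. \<not> Q p} p \<partial>two_point_law \<Lambda> \<tau> u)"
    by (intro nn_integral_indicator[symmetric]) (simp add: sets\<Lambda>)
  also have "\<dots> = 0"
    by (subst nn_integral_two_point_law[OF sets\<Lambda> \<tau> u_meas u]) (auto simp: Q)
  finally show "{p. \<not> Q p} \<in> null_sets (two_point_law \<Lambda> \<tau> u)"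
    by (auto simp: null_sets_def sets\<Lambda>)
qed auto

text \<open>Signed counterpart of \<open>nn_integral_two_point_law\<close>: adding the bound
  \<open>C\<close> makes the integrand nonnegative almost everywhere, and the constant cancels at
  the end since both measures have total mass 1.\<close>

lemma integral_two_point_law:
  fixes \<phi> :: "'a \<times> real \<Rightarrow> real"
  assumes \<phi>: "\<phi> \<in> borel_measurable borel"
    and C: "\<And>x. \<bar>\<phi> (x, \<tau>)\<bar> \<le> C" "\<And>x. \<bar>\<phi> (x, -\<tau>)\<bar> \<le> C"
  shows "(\<integral>p. \<phi> p \<partial>two_point_law \<Lambda> \<tau> u) = (\<integral>x. (1 + u x) / 2 * \<phi> (x, \<tau>) + (1 - u x) / 2 * \<phi> (x, -\<tau>) \<partial>\<Lambda>)"
proof -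
  let ?P = "two_point_law \<Lambda> \<tau> u"
  let ?\<psi> = "\<lambda>x. (1 + u x) / 2 * \<phi> (x, \<tau>) + (1 - u x) / 2 * \<phi> (x, -\<tau>)"
  interpret \<Lambda>: prob_space \<Lambda> by (rule \<Lambda>)
  interpret P: prob_space ?P by (rule prob_space_two_point_law)
  have [measurable]: "\<phi> \<in> borel_measurable (borel \<Otimes>\<^sub>M borel)" using \<phi> by (simp add: borel_prod)
  have [measurable]: "\<phi> \<in> borel_measurable ?P"
    using \<phi> by (simp add: measurable_cong_sets[OF sets_two_point_law[OF sets\<Lambda>] refl])
  have AE: "AE p in ?P. \<bar>\<phi> p\<bar> \<le> C" using \<phi> by (intro AE_two_point_law) (auto simp: C)
  have int: "integrable ?P \<phi>" using AE by (intro P.integrable_const_bound[of _ C]) auto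
  have bd: "\<bar>?\<psi> x\<bar> \<le> C" for x
  proof -
    have "\<bar>?\<psi> x\<bar> \<le> (1 + u x) / 2 * \<bar>\<phi> (x, \<tau>)\<bar> + (1 - u x) / 2 * \<bar>\<phi> (x, -\<tau>)\<bar>"
      using u[of x] by (intro order_trans[OF abs_triangle_ineq]) (auto simp: abs_mult)
    also have "\<dots> \<le> (1 + u x) / 2 * C + (1 - u x) / 2 * C"
      using u[of x] by (intro add_mono mult_left_mono C) auto
    also have "\<dots> = C" by (simp add: field_simps)
    finally show ?thesis .
  qed
  have int\<psi>: "integrable \<Lambda> ?\<psi>" using bd by (intro \<Lambda>.integrable_const_bound[of _ C]) auto
  have "(\<integral>p. \<phi> p + C \<partial>?P) = enn2real (\<integral>\<^sup>+p. ennreal (\<phi> p + C) \<partial>?P)"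
    using AE by (intro integral_eq_nn_integral) auto
  also have "(\<integral>\<^sup>+p. ennreal (\<phi> p + C) \<partial>?P) = (\<integral>\<^sup>+x. ennreal (?\<psi> x + C) \<partial>\<Lambda>)"
  proof -
    have "ennreal ((1 + u x) / 2) * ennreal (\<phi> (x, \<tau>) + C) + ennreal ((1 - u x) / 2) * ennreal (\<phi> (x, -\<tau>) + C)
       = ennreal (?\<psi> x + C)" for x
    proof -
      have nn: "0 \<le> (1 + u x) / 2" "0 \<le> (1 - u x) / 2" "0 \<le> \<phi> (x, \<tau>) + C" "0 \<le> \<phi> (x, -\<tau>) + C"
        using u[of x] C(1)[of x] C(2)[of x] by auto
      have "?\<psi> x + C = (1 + u x) / 2 * (\<phi> (x, \<tau>) + C) + (1 - u x) / 2 * (\<phi> (x, -\<tau>) + C)"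
        by (simp add: field_simps)
      then show ?thesis
        using nn by (simp only: ennreal_mult[symmetric] ennreal_plus[symmetric] mult_nonneg_nonneg)
    qed
    then show ?thesis using \<phi> by (subst nn_integral_two_point_law[OF sets\<Lambda> \<tau> u_meas u]) auto
  qed
  also have "enn2real \<dots> = (\<integral>x. ?\<psi> x + C \<partial>\<Lambda>)"
  proof (intro integral_eq_nn_integral[symmetric] AE_I2)
    show "0 \<le> ?\<psi> x + C" for x using bd[of x] by linarith
  qed measurable
  finally have "(\<integral>p. \<phi> p \<partial>?P) + C = (\<integral>x. ?\<psi> x \<partial>\<Lambda>) + C"
    using int int\<psi> by (simp add: P.prob_space \<Lambda>.prob_space)
  then show ?thesis by simp
qed

text \<open>The integrand on the right is the conditional variance of a label with values
  \<open>\<plusminus>\<tau>\<close> and mean \<open>\<tau> * u x\<close>.\<close>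

lemma R_reg_star_two_point_law:
  "R_reg_star (two_point_law \<Lambda> \<tau> u) (\<lambda>x. \<tau> * u x) = (\<integral>x. \<tau>\<^sup>2 * (1 - (u x)\<^sup>2) \<partial>\<Lambda>)"
proof -
  have m: "(\<lambda>p. (snd p - \<tau> * u (fst p))\<^sup>2) \<in> borel_measurable (borel :: ('a \<times> real) measure)"
    unfolding borel_prod[symmetric] by measurable
  have b: "(t - \<tau> * u x)\<^sup>2 \<le> (2 * \<tau>)\<^sup>2" if "\<bar>t\<bar> \<le> \<tau>" for t x
  proof -
    have "\<bar>\<tau> * u x\<bar> \<le> \<tau> * 1" unfolding abs_mult using \<tau> u[of x] by (intro mult_mono) auto
    then have "\<bar>t - \<tau> * u x\<bar> \<le> \<bar>2 * \<tau>\<bar>" using that by linarith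
    then show ?thesis by (simp only: abs_le_square_iff)
  qed
  have *: "(1 + u x) / 2 * (\<tau> - \<tau> * u x)\<^sup>2 + (1 - u x) / 2 * (-\<tau> - \<tau> * u x)\<^sup>2 = \<tau>\<^sup>2 * (1 - (u x)\<^sup>2)" for x
    by (simp add: power2_eq_square field_simps)
  show ?thesis
    unfolding R_reg_star_def
  proof (subst integral_two_point_law[OF m, of "(2 * \<tau>)\<^sup>2"])
    show "\<bar>(snd (x, \<tau>) - \<tau> * u (fst (x, \<tau>)))\<^sup>2\<bar> \<le> (2 * \<tau>)\<^sup>2"
      "\<bar>(snd (x, -\<tau>) - \<tau> * u (fst (x, -\<tau>)))\<^sup>2\<bar> \<le> (2 * \<tau>)\<^sup>2" for x
      using b[of \<tau> x] b[of "-\<tau>" x] \<tau> by auto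
  qed (simp only: fst_conv snd_conv *)
qed

text \<open>The cross term vanishes because \<open>\<tau> * u x\<close> is the conditional mean of
  the label. Working with nonnegative integrals covers predictors \<open>e\<close> of infinite risk
  as well.\<close>

lemma risk_decomposition:
  assumes [measurable]: "e \<in> borel_measurable borel"
  shows "(\<integral>\<^sup>+p. ennreal ((e (fst p) - snd p)\<^sup>2) \<partial>two_point_law \<Lambda> \<tau> u)
    = ennreal (R_reg_star (two_point_law \<Lambda> \<tau> u) (\<lambda>x. \<tau> * u x)) + (\<integral>\<^sup>+x. ennreal ((e x - \<tau> * u x)\<^sup>2) \<partial>\<Lambda>)"
proof -
  interpret \<Lambda>: prob_space \<Lambda> by (rule \<Lambda>)
  have m: "(\<lambda>p. ennreal ((e (fst p) - snd p)\<^sup>2)) \<in> borel_measurable (borel :: ('a \<times> real) measure)"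
    unfolding borel_prod[symmetric] by measurable
  have u2: "0 \<le> (u x)\<^sup>2" "(u x)\<^sup>2 \<le> 1" for x using u[of x] by (auto simp: abs_square_le_1)
  have "ennreal ((1 + u x) / 2) * ennreal ((e x - \<tau>)\<^sup>2) + ennreal ((1 - u x) / 2) * ennreal ((e x - -\<tau>)\<^sup>2)
     = ennreal (\<tau>\<^sup>2 * (1 - (u x)\<^sup>2)) + ennreal ((e x - \<tau> * u x)\<^sup>2)" for x
  proof -
    have nn: "0 \<le> (1 + u x) / 2" "0 \<le> (1 - u x) / 2" "0 \<le> (e x - \<tau>)\<^sup>2" "0 \<le> (e x - -\<tau>)\<^sup>2"
        "0 \<le> \<tau>\<^sup>2 * (1 - (u x)\<^sup>2)" "0 \<le> (e x - \<tau> * u x)\<^sup>2"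
      using u[of x] u2[of x] by auto
    have "(1 + u x) / 2 * (e x - \<tau>)\<^sup>2 + (1 - u x) / 2 * (e x - -\<tau>)\<^sup>2
      = \<tau>\<^sup>2 * (1 - (u x)\<^sup>2) + (e x - \<tau> * u x)\<^sup>2"
      by (simp add: power2_eq_square field_simps)
    then show ?thesis
      using nn by (simp only: ennreal_mult[symmetric] ennreal_plus[symmetric] mult_nonneg_nonneg)
  qed
  then have "(\<integral>\<^sup>+p. ennreal ((e (fst p) - snd p)\<^sup>2) \<partial>two_point_law \<Lambda> \<tau> u)
    = (\<integral>\<^sup>+x. ennreal (\<tau>\<^sup>2 * (1 - (u x)\<^sup>2)) + ennreal ((e x - \<tau> * u x)\<^sup>2) \<partial>\<Lambda>)"
    by (subst nn_integral_two_point_law[OF sets\<Lambda> \<tau> u_meas u m]) simp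
  also have "\<dots> = (\<integral>\<^sup>+x. ennreal (\<tau>\<^sup>2 * (1 - (u x)\<^sup>2)) \<partial>\<Lambda>) + (\<integral>\<^sup>+x. ennreal ((e x - \<tau> * u x)\<^sup>2) \<partial>\<Lambda>)"
    by (intro nn_integral_add) auto
  also have "(\<integral>\<^sup>+x. ennreal (\<tau>\<^sup>2 * (1 - (u x)\<^sup>2)) \<partial>\<Lambda>) = ennreal (\<integral>x. \<tau>\<^sup>2 * (1 - (u x)\<^sup>2) \<partial>\<Lambda>)"
  proof (intro nn_integral_eq_integral \<Lambda>.integrable_const_bound[of _ "\<tau>\<^sup>2"])
    show "AE x in \<Lambda>. norm (\<tau>\<^sup>2 * (1 - (u x)\<^sup>2)) \<le> \<tau>\<^sup>2"
      using u2 by (intro AE_I2) (auto simp: abs_mult intro!: mult_left_le)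
  qed (use u2 in auto)
  finally show ?thesis by (simp add: R_reg_star_two_point_law)
qed

lemma F_reg1_two_point_law:
  fixes L \<beta> c D T \<theta> :: real
  assumes "\<tau> < T" and "vol_cond X \<theta> D" and [measurable]: "X \<in> sets borel" and AE: "AE x in \<Lambda>. x \<in> X"
    and f: "f \<in> borel_measurable borel" "\<And>x. 0 \<le> f x" "\<And>x. x \<in> X \<Longrightarrow> c \<le> f x" "\<Lambda> = density lborel (\<lambda>x. ennreal (f x))"
    and holder: "\<And>x x'. \<bar>\<tau> * u x - \<tau> * u x'\<bar> \<le> L * norm (x - x') powr \<beta>"
  shows "F_reg1 X L \<beta> c D T \<theta> (two_point_law \<Lambda> \<tau> u) (\<lambda>x. \<tau> * u x)"
proof -
  let ?P = "two_point_law \<Lambda> \<tau> u"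
  interpret \<Lambda>: prob_space \<Lambda> by (rule \<Lambda>)
  have fst_meas: "fst \<in> ?P \<rightarrow>\<^sub>M borel"
    unfolding measurable_cong_sets[OF sets_two_point_law[OF sets\<Lambda>] refl]
    by (intro borel_measurable_continuous_onI continuous_intros)
  have bd: "\<bar>\<tau> * u x\<bar> \<le> \<tau>" for x using u[of x] \<tau> by (simp add: abs_mult mult_left_le)
  have int: "integrable \<Lambda> (\<lambda>x. \<tau> * u x)"
    using bd by (intro \<Lambda>.integrable_const_bound[of _ \<tau>]) auto
  have cond: "(\<integral>p. indicator A (fst p) * snd p \<partial>?P) = (\<integral>x. indicator A x * (\<tau> * u x) \<partial>\<Lambda>)"
    if [measurable]: "A \<in> sets borel" for A
  proof -
    have "(\<lambda>p. indicator A (fst p) * snd p) \<in> borel_measurable (borel :: ('a \<times> real) measure)"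
      unfolding borel_prod[symmetric] by measurable
    then show ?thesis
      using \<tau> by (subst integral_two_point_law[of _ \<tau>])
        (auto simp: indicator_def field_simps intro!: Bochner_Integration.integral_cong)
  qed
  have "AE p in ?P. fst p \<in> X"
    by (rule AE_distrD[OF fst_meas]) (simp only: distr_fst_two_point_law AE)
  moreover have "AE p in ?P. \<bar>snd p\<bar> < T"
  proof (rule AE_two_point_law)
    show "Measurable.pred borel (\<lambda>p::'a \<times> real. \<bar>snd p\<bar> < T)"
      unfolding borel_prod[symmetric] by measurable
  qed (use assms \<tau> in auto)
  moreover have "is_regression_fun ?P (\<lambda>x. \<tau> * u x)"
    unfolding is_regression_fun_def distr_fst_two_point_law using int cond by auto
  ultimately show ?thesis
    unfolding F_reg1_def distr_fst_two_point_law
    using prob_space_two_point_law sets_two_point_law[OF sets\<Lambda>] assms by blast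
qed

end

text \<open>On \<open>B\<close> the two densities are \<open>1 + t\<close> and \<open>1 - t\<close>
  with \<open>\<bar>t\<bar> \<le> w * k\<close>, and their geometric mean
  \<open>sqrt (1 - t\<^sup>2)\<close> is at least \<open>1 - t\<^sup>2\<close>; off \<open>B\<close>
  they coincide. So at most \<open>(w * k)\<^sup>2\<close> times the mass of \<open>B\<close> is
  lost from the total mass 1.\<close>

lemma affinity_lower_bound:
  fixes u u' :: "'a::euclidean_space \<Rightarrow> real" and b :: "'a \<times> 'z \<Rightarrow> real"
  assumes sets [measurable_cong]: "sets \<mu> = sets (borel \<Otimes>\<^sub>M Zs)" and [measurable]: "b \<in> borel_measurable (borel \<Otimes>\<^sub>M Zs)"
    and [measurable]: "u \<in> borel_measurable borel" "u' \<in> borel_measurable borel" "B \<in> sets borel"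
    and p: "prob_space (density \<mu> (\<lambda>s. ennreal (1 + u (fst s) * b s)))"
    and q: "prob_space (density \<mu> (\<lambda>s. ennreal (1 + u' (fst s) * b s)))"
    and out: "\<And>x. x \<notin> B \<Longrightarrow> u' x = u x" and inB: "\<And>x. x \<in> B \<Longrightarrow> u' x = - u x"
    and b: "\<And>s. \<bar>b s\<bar> \<le> k" "k \<le> 1" and u: "\<And>x. \<bar>u x\<bar> \<le> w" "w \<le> 1"
    and marg: "emeasure \<mu> (B \<times> space Zs) \<le> ennreal m" and m: "0 \<le> m"
  shows "ennreal (1 - (w * k)\<^sup>2 * m) \<le> (\<integral>\<^sup>+s. ennreal (sqrt ((1 + u (fst s) * b s) * (1 + u' (fst s) * b s))) \<partial>\<mu>)"
    (is "_ \<le> ?A")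
proof -
  have ub: "\<bar>u (fst s) * b s\<bar> \<le> w * k" for s
    unfolding abs_mult using u(1)[of "fst s"] b(1)[of s] by (intro mult_mono) auto
  \<comment> \<open>The bound on \<open>b\<close> at an arbitrary point shows that \<open>k\<close>
    is nonnegative.\<close>
  have wk: "w * k \<le> 1"
    using b(1)[of undefined] u(2) b(2) by (intro mult_le_one) auto
  have u'b: "u' (fst s) * b s = (if fst s \<in> B then - (u (fst s) * b s) else u (fst s) * b s)" for s
    using out[of "fst s"] inB[of "fst s"] by auto
  have one: "(\<integral>\<^sup>+s. ennreal (1 + v (fst s) * b s) \<partial>\<mu>) = 1"
    if "prob_space (density \<mu> (\<lambda>s. ennreal (1 + v (fst s) * b s)))" and [measurable]: "v \<in> borel_measurable borel" for v
    using prob_space.emeasure_space_1[OF that(1)] by (simp add: emeasure_density cong: nn_integral_cong)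
  \<comment> \<open>The geometric mean is compared with the arithmetic mean, because the latter has
    integral exactly 1.\<close>
  have pw: "(1 + u (fst s) * b s + (1 + u' (fst s) * b s)) / 2
      \<le> sqrt ((1 + u (fst s) * b s) * (1 + u' (fst s) * b s)) + (w * k)\<^sup>2 * indicator B (fst s)" for s
  proof (cases "fst s \<in> B")
    case False
    then show ?thesis using ub[of s] wk by (simp add: u'b)
  next
    case True
    define t where "t = u (fst s) * b s"
    have t: "\<bar>t\<bar> \<le> w * k" "\<bar>t\<bar> \<le> 1" using ub[of s] wk unfolding t_def by linarith+
    have t2: "t\<^sup>2 \<le> (w * k)\<^sup>2" using t(1) by (metis abs_ge_zero power2_abs power_mono)
    have "t\<^sup>2 \<le> 1" using t(2) by (simp add: abs_square_le_1)
    then have "(1 - t\<^sup>2)\<^sup>2 \<le> 1 - t\<^sup>2" by (simp add: power2_eq_square mult_left_le)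
    then have "1 - t\<^sup>2 \<le> sqrt (1 - t\<^sup>2)" by (rule real_le_rsqrt)
    moreover have "(1 + t) * (1 + u' (fst s) * b s) = 1 - t\<^sup>2"
      using inB[OF True] by (simp add: t_def power2_eq_square algebra_simps)
    ultimately show ?thesis using True t2 by (simp add: u'b t_def[symmetric])
  qed
  have nn: "0 \<le> 1 + u (fst s) * b s" "0 \<le> 1 + u' (fst s) * b s" for s
    using ub[of s] wk by (auto simp: u'b abs_le_iff)
  have "2 = (\<integral>\<^sup>+s. ennreal (1 + u (fst s) * b s) \<partial>\<mu>) + (\<integral>\<^sup>+s. ennreal (1 + u' (fst s) * b s) \<partial>\<mu>)"
    using one[OF p] one[OF q] by simp
  also have "\<dots> = (\<integral>\<^sup>+s. ennreal (1 + u (fst s) * b s) + ennreal (1 + u' (fst s) * b s) \<partial>\<mu>)"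
    by (rule nn_integral_add[symmetric]) measurable
  also have "\<dots> \<le> (\<integral>\<^sup>+s. 2 * (ennreal (sqrt ((1 + u (fst s) * b s) * (1 + u' (fst s) * b s)))
       + ennreal ((w * k)\<^sup>2) * indicator (B \<times> space Zs) s) \<partial>\<mu>)"
  proof (intro nn_integral_mono)
    fix s assume "s \<in> space \<mu>"
    then have ind: "indicator (B \<times> space Zs) s = ennreal (indicator B (fst s))"
      using sets_eq_imp_space_eq[OF sets] by (auto simp: space_pair_measure indicator_def)
    have "ennreal (1 + u (fst s) * b s) + ennreal (1 + u' (fst s) * b s)
       = ennreal (1 + u (fst s) * b s + (1 + u' (fst s) * b s))"
      by (rule ennreal_plus[symmetric]) (rule nn)+
    also have "\<dots> \<le> ennreal (2 * (sqrt ((1 + u (fst s) * b s) * (1 + u' (fst s) * b s)) + (w * k)\<^sup>2 * indicator B (fst s)))"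
      by (intro ennreal_leI order_trans[OF _ mult_left_mono[OF pw]]) simp_all
    also have "\<dots> = 2 * (ennreal (sqrt ((1 + u (fst s) * b s) * (1 + u' (fst s) * b s)))
       + ennreal ((w * k)\<^sup>2) * indicator (B \<times> space Zs) s)"
      unfolding ind using nn[of s] by (simp add: ennreal_mult)
    finally show "ennreal (1 + u (fst s) * b s) + ennreal (1 + u' (fst s) * b s) \<le> \<dots>" .
  qed
  also have "\<dots> = 2 * (?A + ennreal ((w * k)\<^sup>2) * emeasure \<mu> (B \<times> space Zs))"
    by (simp add: nn_integral_cmult nn_integral_add nn_integral_cmult_indicator)
  also have "\<dots> \<le> 2 * (?A + ennreal ((w * k)\<^sup>2) * ennreal m)"
    by (intro mult_left_mono add_left_mono marg) auto
  finally have "2 * 1 \<le> 2 * (?A + ennreal ((w * k)\<^sup>2 * m))" using m by (simp add: ennreal_mult)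
  then have *: "1 \<le> ?A + ennreal ((w * k)\<^sup>2 * m)"
    by (subst (asm) ennreal_mult_le_mult_iff) auto
  show ?thesis
  proof (cases ?A)
    case (real r)
    have "ennreal 1 \<le> ennreal (r + (w * k)\<^sup>2 * m)" using * real m by (simp add: ennreal_plus[symmetric] del: ennreal_plus)
    then have "1 \<le> r + (w * k)\<^sup>2 * m" using real m by (subst (asm) ennreal_le_iff) auto
    then show ?thesis unfolding real(2) by (intro ennreal_leI) simp
  qed simp
qed

section \<open>Averaging over sign patterns\<close>

text \<open>Two patterns that differ only at \<open>j\<close> give opposite functions on the ball
  around \<open>j\<close> and equal functions outside it, as \<open>affinity_lower_bound\<close>
  requires.\<close>

lemma bump_sum_insert:
  assumes J: "finite J" "separated (2*h) J" and j: "j \<in> J" and V: "V \<subseteq> J - {j}"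
  shows "dist x j \<le> h \<Longrightarrow> bump_sum A h \<beta> J (insert j V) x = A * bump h \<beta> j x"
    and "dist x j \<le> h \<Longrightarrow> bump_sum A h \<beta> J V x = - (A * bump h \<beta> j x)"
    and "h \<le> dist x j \<Longrightarrow> bump_sum A h \<beta> J (insert j V) x = bump_sum A h \<beta> J V x"
proof -
  show "dist x j \<le> h \<Longrightarrow> bump_sum A h \<beta> J (insert j V) x = A * bump h \<beta> j x"
    and "dist x j \<le> h \<Longrightarrow> bump_sum A h \<beta> J V x = - (A * bump h \<beta> j x)"
    using V by (auto simp: bump_sum_eq_single[OF J j] bump_sign_def)
  show "bump_sum A h \<beta> J (insert j V) x = bump_sum A h \<beta> J V x" if "h \<le> dist x j"
    unfolding bump_sum_def
    by (intro sum.cong) (use that in \<open>auto simp: bump_sign_def bump_eq_0\<close>)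
qed

text \<open>Groups the sign patterns into pairs that differ only at \<open>j\<close>, so that a
  two-point bound can be applied to each pair.\<close>

lemma sum_Pow_pairs:
  fixes F :: "'b set \<Rightarrow> 'c::comm_monoid_add"
  assumes "finite J" "j \<in> J"
  shows "(\<Sum>V\<in>Pow J. F V) = (\<Sum>V\<in>Pow (J - {j}). F (insert j V) + F V)"
proof -
  have "Pow J = Pow (J - {j}) \<union> insert j ` Pow (J - {j})"
    using Pow_insert[of j "J - {j}"] assms by (simp add: insert_absorb)
  moreover have "Pow (J - {j}) \<inter> insert j ` Pow (J - {j}) = {}" by auto
  moreover have "inj_on (insert j) (Pow (J - {j}))" by (auto simp: inj_on_def)
  ultimately show ?thesis
    using assms by (simp add: sum.union_disjoint sum.reindex sum.distrib add.commute)
qed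

lemma exists_ge_average_ennreal:
  fixes F :: "'b \<Rightarrow> ennreal"
  assumes "finite S" "S \<noteq> {}" "of_nat (card S) * R \<le> (\<Sum>V\<in>S. F V)"
  shows "\<exists>V\<in>S. R \<le> F V"
proof -
  have "Max (F ` S) \<in> F ` S" using assms by (intro Max_in) auto
  then obtain V where V: "V \<in> S" "F V = Max (F ` S)" by auto
  have "(\<Sum>V\<in>S. F V) \<le> of_nat (card S) * F V"
    using assms unfolding V(2) by (intro sum_bounded_above) auto
  then have "of_nat (card S) * R \<le> of_nat (card S) * F V" using assms(3) by (rule order_trans[rotated])
  moreover have "0 < card S" using assms by (simp add: card_gt_0_iff)
  ultimately have "R \<le> F V"
    by (subst (asm) ennreal_mult_le_mult_iff) auto
  then show ?thesis using V by blast
qed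

text \<open>The hypothesis on \<open>N\<close> keeps the squared affinity of two neighbouring
  patterns over the whole sample at 1/2 or more. In the resulting excess,
  \<open>A\<^sup>2 * ((h/2) powr \<beta>)\<^sup>2\<close> is the least squared bump height on the
  half-radius balls, and \<open>\<theta> / 4 ^ DIM('a)\<close> bounds from below the share of
  \<open>X\<close> that these balls fill.\<close>

lemma minimax_lower_bound_at_scale:
  fixes L \<beta> c D T \<theta> \<tau> A h \<epsilon> :: real and X :: "'a::euclidean_space set" and Zs :: "'z measure"
  assumes pos: "0 < A" "2 * A \<le> L" "0 < \<beta>" "\<beta> \<le> 1" "0 < c" "0 < \<tau>" "\<tau> < T" "0 < \<theta>"
    and X: "X \<in> sets borel" "vol_cond X \<theta> D" "ennreal c * emeasure lborel X \<le> 1"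
    and vol: "0 < measure lborel X" "emeasure lborel X < \<infinity>"
    and h: "0 < h" "h < D" "A * h powr \<beta> \<le> \<tau>"
    and N: "4 * real N * (A * h powr \<beta> / \<tau> * min \<epsilon> 1)\<^sup>2 * (measure lborel (ball (0::'a) 1) * h ^ DIM('a)) \<le> measure lborel X"
    and M: "0 < \<epsilon>" "label_LDP \<epsilon> Zs M" and est: "estimator N Zs est"
  shows "\<exists>P \<eta>. F_reg1 X L \<beta> c D T \<theta> P \<eta> \<and>
     ennreal (R_reg_star P \<eta>) + ennreal (A\<^sup>2 * ((h/2) powr \<beta>)\<^sup>2 / 2 * \<theta> / 4 ^ DIM('a)) \<le> R_reg N P Zs M est"
proof -
  define v where "v = measure lborel (ball (0::'a) 1)"
  have v: "0 < v" unfolding v_def by (rule content_ball_pos) simp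
  define vX where "vX = measure lborel X"
  have vX: "0 < vX" "emeasure lborel X = ennreal vX"
    using vol by (auto simp: vX_def emeasure_eq_ennreal_measure)
  define \<Lambda> where "\<Lambda> = uniform_measure lborel X"
  have \<Lambda>: "prob_space \<Lambda>"
    unfolding \<Lambda>_def using vX by (intro prob_space_uniform_measure) auto
  interpret \<Lambda>: prob_space \<Lambda> by fact
  have sets\<Lambda> [measurable_cong]: "sets \<Lambda> = sets borel" by (simp add: \<Lambda>_def)
  have e\<Lambda>: "emeasure \<Lambda> B = emeasure lborel (X \<inter> B) / ennreal vX" if "B \<in> sets borel" for B
    unfolding \<Lambda>_def using that X by (simp add: vX)
  have AEX: "AE x in \<Lambda>. x \<in> X"
    unfolding \<Lambda>_def using X by (intro AE_uniform_measureI) auto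
  have dens: "\<Lambda> = density lborel (\<lambda>x. ennreal (indicator X x / vX))"
    unfolding \<Lambda>_def uniform_measure_def vX(2) using vX(1)
    by (intro arg_cong[of _ _ "density lborel"] ext) (auto simp: indicator_def divide_ennreal[symmetric])
  \<comment> \<open>The uniform density is at least \<open>c\<close> on \<open>X\<close> because
    \<open>c\<close> times the volume of \<open>X\<close> is at most 1.\<close>
  have c: "c \<le> 1 / vX"
  proof -
    have "ennreal (c * vX) \<le> ennreal 1" using X(3) vX pos by (simp add: ennreal_mult)
    then have "c * vX \<le> 1" by (subst (asm) ennreal_le_iff) auto
    then show ?thesis using vX by (simp add: field_simps)
  qed
  obtain J where J: "J \<subseteq> X" "finite J" "separated (2*h) J"
    and cardJ: "vX \<le> real (card J) * (v * (2*h) ^ DIM('a))"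
    using exists_packing[OF X(2,1) vol(2) h(1,2) pos(8)] unfolding v_def vX_def by blast
  define \<eta> where "\<eta> V = bump_sum A h \<beta> J V" for V
  define u where "u V x = \<eta> V x / \<tau>" for V x
  define w where "w = A * h powr \<beta> / \<tau>"
  have w: "0 \<le> w" "w \<le> 1" using pos h by (auto simp: w_def)
  have \<eta>u: "\<eta> V = (\<lambda>x. \<tau> * u V x)" for V using pos by (auto simp: u_def)
  have uw: "\<bar>u V x\<bar> \<le> w" for V x
    using bump_sum_abs_le[OF J(2,3) h(1) pos(3), of A V x] pos
    by (simp add: u_def w_def \<eta>_def divide_right_mono)
  then have u1: "\<bar>u V x\<bar> \<le> 1" for V x using w by (meson order_trans)
  have [measurable]: "\<eta> V \<in> borel_measurable borel" for V unfolding \<eta>_def by measurable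
  have um [measurable]: "u V \<in> borel_measurable borel" for V unfolding u_def by measurable
  define P where "P V = two_point_law \<Lambda> \<tau> (u V)" for V
  have F: "F_reg1 X L \<beta> c D T \<theta> (P V) (\<eta> V)" for V
    unfolding P_def \<eta>u
  proof (rule F_reg1_two_point_law[OF \<Lambda> sets\<Lambda> pos(6) um u1 pos(7) X(2,1) AEX _ _ _ dens])
    fix x x' :: 'a
    have "\<bar>\<eta> V x - \<eta> V x'\<bar> \<le> 2 * A * norm (x - x') powr \<beta>"
      unfolding \<eta>_def using pos by (intro bump_sum_holder J h) auto
    also have "\<dots> \<le> L * norm (x - x') powr \<beta>" using pos by (intro mult_right_mono) auto
    finally show "\<bar>\<tau> * u V x - \<tau> * u V x'\<bar> \<le> L * norm (x - x') powr \<beta>" unfolding \<eta>u .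
  qed (use X(1) vX c in auto)
  define k where "k = min \<epsilon> 1"
  have k: "0 \<le> k" "k \<le> 1" using M by (auto simp: k_def)
  obtain \<mu> b where \<mu>: "prob_space \<mu>" and sets\<mu>: "sets \<mu> = sets (borel \<Otimes>\<^sub>M Zs)"
    and b [measurable]: "b \<in> borel_measurable (borel \<Otimes>\<^sub>M Zs)" and bk: "\<And>s. \<bar>b s\<bar> \<le> min \<epsilon> (1::real)"
    and marg: "\<And>B. B \<in> sets borel \<Longrightarrow> emeasure \<mu> (B \<times> space Zs) = emeasure \<Lambda> B"
    and priv: "\<And>u. u \<in> borel_measurable borel \<Longrightarrow> (\<And>x. \<bar>u x\<bar> \<le> 1) \<Longrightarrow>
       priv_law (two_point_law \<Lambda> \<tau> u) Zs M = density \<mu> (\<lambda>s. ennreal (1 + u (fst s) * b s))"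
    by (rule priv_law_two_point_law[OF M(2,1) pos(6) \<Lambda> sets\<Lambda>]) blast
  note bk = bk[folded k_def]
  note sets\<mu>[measurable_cong]
  have pl: "priv_law (P V) Zs M = density \<mu> (\<lambda>s. ennreal (1 + u V (fst s) * b s))" for V
    unfolding P_def by (rule priv[OF um u1])
  \<comment> \<open>Total mass 1 follows from the origin of this measure: it is a probability law
    composed with a probability kernel.\<close>
  have ppl: "prob_space (density \<mu> (\<lambda>s. ennreal (1 + u V (fst s) * b s)))" for V
  proof -
    have sP: "sets (P V) = sets borel" unfolding P_def by (simp add: sets\<Lambda>)
    have "(\<lambda>p. distr (M p) (borel \<Otimes>\<^sub>M Zs) (\<lambda>z. (fst p, z))) \<in> P V \<rightarrow>\<^sub>M prob_algebra (borel \<Otimes>\<^sub>M Zs)"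
      unfolding measurable_cong_sets[OF sP refl] borel_prod[symmetric]
      using M(2) unfolding label_LDP_def borel_prod[symmetric]
      by (intro measurable_distr_prob_space2[where M=Zs]) auto
    moreover have "P V \<in> space (prob_algebra (P V))"
      unfolding P_def by (simp add: space_prob_algebra prob_space_two_point_law[OF \<Lambda> sets\<Lambda> pos(6) um u1])
    ultimately show ?thesis
      unfolding pl[symmetric] priv_law_def
      by (intro prob_space_bind'[where M="P V"])
  qed
  define r where "r = v * h ^ DIM('a) / vX"
  \<comment> \<open>A lower bound on the affinity for one observation. The mass of a ball is at most
    \<open>r\<close> but also at most 1; the minimum with 1 keeps \<open>B\<close>
    nonnegative.\<close>
  define B where "B = 1 - (w * k)\<^sup>2 * min 1 r"
  have r0: "0 \<le> r" using v h vX by (simp add: r_def)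
  have wk: "(w * k)\<^sup>2 \<le> 1" using w k by (simp add: power_le_one mult_le_one)
  have B0: "0 \<le> B" "B \<le> 1" using wk r0 by (auto simp: B_def mult_le_one)
  \<comment> \<open>By Bernoulli's inequality, since \<open>2 * N\<close> times the loss of affinity
    per observation is at most 1/2.\<close>
  have BN: "1 / 2 \<le> B ^ (2 * N)"
  proof -
    have "4 * real N * (w * k)\<^sup>2 * (v * h ^ DIM('a)) \<le> vX"
      using N unfolding w_def k_def v_def vX_def .
    then have "4 * real N * (w * k)\<^sup>2 * r \<le> 1" using vX by (simp add: r_def pos_divide_le_eq)
    moreover have "4 * real N * (w * k)\<^sup>2 * min 1 r \<le> 4 * real N * (w * k)\<^sup>2 * r" by (intro mult_left_mono) auto
    ultimately have "1 / 2 \<le> 1 + real (2 * N) * (B - 1)" by (simp add: B_def)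
    also have "\<dots> \<le> (1 + (B - 1)) ^ (2 * N)" using B0 by (intro Bernoulli_inequality) simp
    finally show ?thesis by simp
  qed
  have \<Lambda>ball: "emeasure \<Lambda> (ball j h) \<le> ennreal (min 1 r)" for j
  proof -
    have "emeasure \<Lambda> (ball j h) \<le> emeasure lborel (ball j h) / ennreal vX"
      unfolding e\<Lambda>[OF borel_open[OF open_ball]] by (intro divide_right_mono_ennreal emeasure_mono) auto
    also have "emeasure lborel (ball j h) = ennreal (measure lborel (ball j h))"
      using emeasure_lborel_ball_finite[of j h] by (intro emeasure_eq_ennreal_measure) auto
    also have "\<dots> / ennreal vX = ennreal r"
      using vX h v content_ball_conv_unit_ball[of h j]
      by (simp add: divide_ennreal r_def v_def mult.commute)
    finally show ?thesis using \<Lambda>.emeasure_le_1 by (auto simp: min_def)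
  qed
  have setsS: "sets (PiM {..<N} (\<lambda>_. priv_law (P V) Zs M)) = sets (sample_space N Zs :: (nat \<Rightarrow> 'a \<times> 'z) measure)" for V
    unfolding sample_space_def pl by (intro sets_PiM_cong) (auto simp: sets\<mu>)
  have setsS\<mu>: "sets (PiM {..<N} (\<lambda>_. \<mu>)) = sets (sample_space N Zs :: (nat \<Rightarrow> 'a \<times> 'z) measure)"
    unfolding sample_space_def by (intro sets_PiM_cong) (auto simp: sets\<mu>)
  have est_m [measurable]: "(\<lambda>(s, x). est s x) \<in> borel_measurable (sample_space N Zs \<Otimes>\<^sub>M borel)"
    using est by (simp add: estimator_def)
  \<comment> \<open>The mean squared error at the single point \<open>x\<close>. By Fubini the
    excess risk is its integral over \<open>\<Lambda>\<close>, so the sign patterns can be averaged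
    separately at each \<open>x\<close>.\<close>
  define E where "E V x = (\<integral>\<^sup>+s. ennreal ((est s x - \<eta> V x)\<^sup>2) \<partial>PiM {..<N} (\<lambda>_. priv_law (P V) Zs M))" for V x
  have pPi: "prob_space (PiM {..<N} (\<lambda>_. priv_law (P V) Zs M))" for V
    unfolding pl by (intro prob_space_PiM ppl)
  have E_m: "E V \<in> borel_measurable borel"
    and risk: "R_reg N (P V) Zs M est = ennreal (R_reg_star (P V) (\<eta> V)) + (\<integral>\<^sup>+x. E V x \<partial>\<Lambda>)" for V
  proof -
    let ?S = "PiM {..<N} (\<lambda>_. priv_law (P V) Zs M)"
    interpret S: prob_space ?S by (rule pPi)
    interpret pair_sigma_finite ?S \<Lambda> by standard
    note setsS[of V, measurable_cong]
    have m: "(\<lambda>(s, x). ennreal ((est s x - \<eta> V x)\<^sup>2)) \<in> borel_measurable (?S \<Otimes>\<^sub>M \<Lambda>)"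
      by measurable
    have "(\<lambda>(x, s). ennreal ((est s x - \<eta> V x)\<^sup>2)) \<in> borel_measurable (borel \<Otimes>\<^sub>M ?S)"
      by measurable
    then show "E V \<in> borel_measurable borel"
      unfolding E_def[abs_def] by (rule S.borel_measurable_nn_integral)
    have "R_reg N (P V) Zs M est
       = (\<integral>\<^sup>+s. ennreal (R_reg_star (P V) (\<eta> V)) + (\<integral>\<^sup>+x. ennreal ((est s x - \<eta> V x)\<^sup>2) \<partial>\<Lambda>) \<partial>?S)"
      unfolding R_reg_def
    proof (intro nn_integral_cong)
      fix s assume "s \<in> space ?S"
      then have s: "s \<in> space (sample_space N Zs)" using sets_eq_imp_space_eq[OF setsS] by simp
      have "(\<lambda>x. est s x) \<in> borel_measurable borel"
        using measurable_compose[OF measurable_Pair1'[OF s] est_m] by simp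
      then show "(\<integral>\<^sup>+p. ennreal ((est s (fst p) - snd p)\<^sup>2) \<partial>P V)
         = ennreal (R_reg_star (P V) (\<eta> V)) + (\<integral>\<^sup>+x. ennreal ((est s x - \<eta> V x)\<^sup>2) \<partial>\<Lambda>)"
        unfolding P_def \<eta>u by (rule risk_decomposition[OF \<Lambda> sets\<Lambda> pos(6) um u1])
    qed
    also have "\<dots> = ennreal (R_reg_star (P V) (\<eta> V)) + (\<integral>\<^sup>+s. \<integral>\<^sup>+x. ennreal ((est s x - \<eta> V x)\<^sup>2) \<partial>\<Lambda> \<partial>?S)"
      using m by (subst nn_integral_add) (auto simp: S.emeasure_space_1 intro!: \<Lambda>.borel_measurable_nn_integral)
    also have "(\<integral>\<^sup>+s. \<integral>\<^sup>+x. ennreal ((est s x - \<eta> V x)\<^sup>2) \<partial>\<Lambda> \<partial>?S) = (\<integral>\<^sup>+x. E V x \<partial>\<Lambda>)"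
      unfolding E_def by (rule Fubini'[OF m, symmetric])
    finally show "R_reg N (P V) Zs M est = ennreal (R_reg_star (P V) (\<eta> V)) + (\<integral>\<^sup>+x. E V x \<partial>\<Lambda>)" .
  qed
  \<comment> \<open>Half of the least squared height on a half-radius ball. Each pair of patterns
    contributes at least \<open>2 * G\<close>, hence \<open>G\<close> per pattern on
    average.\<close>
  define G where "G = A\<^sup>2 * ((h/2) powr \<beta>)\<^sup>2 / 2"
  have G0: "0 \<le> G" by (simp add: G_def)
  have pair: "ennreal (2 * G) \<le> E (insert j V) x + E V x"
    if j: "j \<in> J" and V: "V \<subseteq> J - {j}" and x: "x \<in> ball j (h/2)" for j V x
  proof -
    define g where "g = A * bump h \<beta> j x"
    have xj: "dist x j \<le> h" using x h by (auto simp: dist_commute)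
    have \<eta>g: "\<eta> (insert j V) x = g" "\<eta> V x = - g"
      using bump_sum_insert[OF J(2,3) j V] xj by (auto simp: \<eta>_def g_def)
    have nn: "0 \<le> 1 + u V (fst s) * b s" for V s
    proof -
      have "\<bar>u V (fst s) * b s\<bar> \<le> 1" unfolding abs_mult using u1[of V "fst s"] bk[of s] k by (intro mult_le_one) auto
      then show ?thesis by linarith
    qed
    have aff: "ennreal B \<le> (\<integral>\<^sup>+s. ennreal (sqrt ((1 + u (insert j V) (fst s) * b s) * (1 + u V (fst s) * b s))) \<partial>\<mu>)"
      unfolding B_def
    proof (rule affinity_lower_bound[OF sets\<mu> b um um _ ppl ppl, where B="ball j h"])
      show "u V x = u (insert j V) x" if "x \<notin> ball j h" for x
        using bump_sum_insert(3)[OF J(2,3) j V] that by (auto simp: u_def \<eta>_def dist_commute)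
      show "u V x = - u (insert j V) x" if "x \<in> ball j h" for x
        using bump_sum_insert(1,2)[OF J(2,3) j V, of x] that by (auto simp: u_def \<eta>_def dist_commute)
      show "emeasure \<mu> (ball j h \<times> space Zs) \<le> ennreal (min 1 r)"
        using \<Lambda>ball by (simp add: marg)
    qed (use bk k uw w r0 in auto)
    have em: "(\<lambda>s. est s x) \<in> borel_measurable (PiM {..<N} (\<lambda>_. \<mu>))"
      unfolding measurable_cong_sets[OF setsS\<mu> refl]
      using measurable_compose[OF measurable_Pair2' est_m, of x] by simp
    have "(h/2) powr \<beta> \<le> bump h \<beta> j x" using bump_ge[OF x h(1) pos(3)] .
    then have "A * (h/2) powr \<beta> \<le> g" using pos unfolding g_def by (intro mult_left_mono) auto
    then have "(A * (h/2) powr \<beta>)\<^sup>2 \<le> g\<^sup>2" using pos by (intro power_mono) auto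
    then have "2 * G \<le> g\<^sup>2 * 1" by (simp add: G_def power_mult_distrib)
    also have "\<dots> \<le> g\<^sup>2 * (2 * B ^ (2 * N))" using BN by (intro mult_left_mono) auto
    finally have "ennreal (2 * G) \<le> ennreal (2 * g\<^sup>2 * B ^ (2 * N))" by (intro ennreal_leI) (simp add: mult_ac)
    also have "\<dots> \<le> E (insert j V) x + E V x"
      using two_point_bound_iid[OF \<mu> _ _ nn nn ppl ppl B0(1) aff em, of g]
      unfolding E_def \<eta>g pl by simp
    finally show ?thesis .
  qed
  \<comment> \<open>At most one half-radius ball contains \<open>x\<close>. Its centre
    \<open>j\<close> decides how the patterns are paired at this point: there are
    \<open>2 ^ (card J - 1)\<close> pairs, each contributing \<open>2 * G\<close>.\<close>
  have ptw: "(\<Sum>j\<in>J. ennreal (2 ^ card J * G) * indicator (ball j (h/2)) x) \<le> (\<Sum>V\<in>Pow J. E V x)" for x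
  proof (cases "\<exists>j\<in>J. x \<in> ball j (h/2)")
    case False
    then show ?thesis by (simp add: indicator_def)
  next
    case True
    then obtain j where j: "j \<in> J" "x \<in> ball j (h/2)" by auto
    have "x \<notin> ball i (h/2)" if "i \<in> J" "i \<noteq> j" for i
    proof
      assume "x \<in> ball i (h/2)"
      then have "dist i j < h" using j(2) dist_triangle_half_l[of x i h j] dist_triangle[of i j x] by (auto simp: dist_commute)
      moreover have "2 * h \<le> dist i j" using J(3) that j(1) by (auto simp: separated_def)
      ultimately show False using h by simp
    qed
    then have "(\<Sum>j\<in>J. ennreal (2 ^ card J * G) * indicator (ball j (h/2)) x) = ennreal (2 ^ card J * G)"
      using J(2) j by (subst sum.remove[of _ j]) (auto intro!: sum.neutral)
    also have "\<dots> = (\<Sum>V\<in>Pow (J - {j}). ennreal (2 * G))"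
    proof -
      have "card J = Suc (card (J - {j}))" using J(2) j(1) by (metis card_Suc_Diff1)
      then show ?thesis using J(2) G0
        by (simp add: card_Pow ennreal_mult' mult_ac ennreal_power[symmetric])
    qed
    also have "\<dots> \<le> (\<Sum>V\<in>Pow (J - {j}). E (insert j V) x + E V x)"
      using pair[OF j(1) _ j(2)] by (intro sum_mono) auto
    also have "\<dots> = (\<Sum>V\<in>Pow J. E V x)" by (rule sum_Pow_pairs[OF J(2) j(1), symmetric])
    finally show ?thesis .
  qed
  define R where "R = A\<^sup>2 * ((h/2) powr \<beta>)\<^sup>2 / 2 * \<theta> / 4 ^ DIM('a)"
  have "of_nat (card (Pow J)) * ennreal R \<le> (\<Sum>V\<in>Pow J. \<integral>\<^sup>+x. E V x \<partial>\<Lambda>)"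
  proof -
    \<comment> \<open>The centres lie in \<open>X\<close>, so \<open>vol_cond\<close> applies to
      them at radius \<open>h/2\<close>.\<close>
    have ball_ge: "ennreal (\<theta> * v * (h/2) ^ DIM('a) / vX) \<le> emeasure \<Lambda> (ball j (h/2))" if "j \<in> J" for j
    proof -
      have "ennreal (\<theta> * v * (h/2) ^ DIM('a)) \<le> emeasure lborel (ball j (h/2) \<inter> X)"
        using X(2) that J(1) h unfolding vol_cond_def v_def by auto
      then have "ennreal (\<theta> * v * (h/2) ^ DIM('a)) / ennreal vX \<le> emeasure lborel (X \<inter> ball j (h/2)) / ennreal vX"
        by (intro divide_right_mono_ennreal) (simp add: Int_commute)
      then show ?thesis using vX v h pos by (simp add: e\<Lambda> divide_ennreal)
    qed
    \<comment> \<open>The packing bound uses balls of radius \<open>2*h\<close> and the error is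
      collected on balls of radius \<open>h/2\<close>; the ratio 4 of the radii yields
      \<open>4 ^ DIM('a)\<close>.\<close>
    have "R \<le> G * (real (card J) * (\<theta> * v * (h/2) ^ DIM('a) / vX))"
    proof -
      have "vX * (\<theta> / 4 ^ DIM('a)) \<le> real (card J) * (v * (2*h) ^ DIM('a)) * (\<theta> / 4 ^ DIM('a))"
        using cardJ pos by (intro mult_right_mono) auto
      also have "\<dots> = real (card J) * (\<theta> * v * (h/2) ^ DIM('a))"
      proof -
        have "(2*h) ^ DIM('a) / 4 ^ DIM('a) = (h/2) ^ DIM('a)"
          by (subst power_divide[symmetric]) simp
        then have "real (card J) * \<theta> * v * ((2*h) ^ DIM('a) / 4 ^ DIM('a)) = real (card J) * \<theta> * v * (h/2) ^ DIM('a)"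
          by simp
        then show ?thesis by (simp add: mult_ac)
      qed
      finally have "\<theta> / 4 ^ DIM('a) \<le> real (card J) * (\<theta> * v * (h/2) ^ DIM('a) / vX)"
        using vX by (simp add: pos_le_divide_eq mult.commute)
      then have "G * (\<theta> / 4 ^ DIM('a)) \<le> G * (real (card J) * (\<theta> * v * (h/2) ^ DIM('a) / vX))"
        using G0 by (intro mult_left_mono) auto
      then show ?thesis by (simp add: R_def G_def)
    qed
    then have "2 ^ card J * R \<le> 2 ^ card J * (G * (real (card J) * (\<theta> * v * (h/2) ^ DIM('a) / vX)))"
      by (intro mult_left_mono) auto
    moreover have "of_nat (card (Pow J)) * ennreal R = ennreal (2 ^ card J * R)"
      using J(2) by (simp add: card_Pow ennreal_mult' ennreal_power[symmetric])
    ultimately have "of_nat (card (Pow J)) * ennreal R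
       \<le> ennreal (2 ^ card J * (G * (real (card J) * (\<theta> * v * (h/2) ^ DIM('a) / vX))))"
      by (simp only: ennreal_leI)
    also have "\<dots> = (\<Sum>j\<in>J. ennreal (2 ^ card J * G) * ennreal (\<theta> * v * (h/2) ^ DIM('a) / vX))"
      using G0 v vX h pos by (simp add: ennreal_mult'[symmetric] ennreal_of_nat_eq_real_of_nat mult_ac)
    also have "\<dots> \<le> (\<Sum>j\<in>J. ennreal (2 ^ card J * G) * emeasure \<Lambda> (ball j (h/2)))"
      by (intro sum_mono mult_left_mono ball_ge) auto
    also have "\<dots> = (\<integral>\<^sup>+x. (\<Sum>j\<in>J. ennreal (2 ^ card J * G) * indicator (ball j (h/2)) x) \<partial>\<Lambda>)"
      by (subst nn_integral_sum) (measurable, simp_all add: nn_integral_cmult_indicator sets\<Lambda>)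
    also have "\<dots> \<le> (\<integral>\<^sup>+x. (\<Sum>V\<in>Pow J. E V x) \<partial>\<Lambda>)"
      by (intro nn_integral_mono ptw)
    also have "\<dots> = (\<Sum>V\<in>Pow J. \<integral>\<^sup>+x. E V x \<partial>\<Lambda>)"
      using E_m by (intro nn_integral_sum) (simp add: measurable_cong_sets[OF sets\<Lambda> refl])
    finally show ?thesis .
  qed
  then obtain V where "ennreal R \<le> (\<integral>\<^sup>+x. E V x \<partial>\<Lambda>)"
    using exists_ge_average_ennreal[of "Pow J"] J(2) by blast
  then have "ennreal (R_reg_star (P V) (\<eta> V)) + ennreal R \<le> R_reg N (P V) Zs M est"
    unfolding risk by (intro add_left_mono)
  then show ?thesis using F unfolding R_def by blast
qed

text \<open>\<open>C\<close> and \<open>n0\<close> are fixed before the sample size, privacy level,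
  mechanism and estimator, while the bad distribution may depend on all of them; this expresses the
  two infima over a supremum. What remains for the proof is to choose the scale
  \<open>h\<close>.\<close>

theorem theorem5:
  fixes L \<beta> c D T \<theta> :: real and X :: "'a::euclidean_space set"
  assumes "L > 0" "\<beta> > 0" "\<beta> \<le> 1" "c > 0" "D > 0" "T > 0" "\<theta> > 0" "\<theta> \<le> 1"
    and "X \<in> sets lborel" "X \<noteq> {}" "vol_cond X \<theta> D"
    and "ennreal c * emeasure lborel X \<le> 1"
  shows "\<exists>C > 0. \<exists>n0. \<forall>(N::nat) (\<epsilon>::real). \<epsilon> > 0 \<and> real N * min (\<epsilon>\<^sup>2) 1 \<ge> n0 \<longrightarrow>
           (\<forall>(Zs :: 'z measure) M est. label_LDP \<epsilon> Zs M \<and> estimator N Zs est \<longrightarrow>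
              (\<exists>P \<eta>. F_reg1 X L \<beta> c D T \<theta> P \<eta> \<and>
                 ennreal (R_reg_star P \<eta>)
                   + ennreal (C * (real N * min (\<epsilon>\<^sup>2) 1) powr (- (2 * \<beta> / (DIM('a) + 2 * \<beta>))))
                 \<le> R_reg N P Zs M est))"
proof -
  define v where "v = measure lborel (ball (0::'a) 1)"
  have v: "0 < v" unfolding v_def by (rule content_ball_pos) simp
  have fin: "emeasure lborel X < \<infinity>"
  proof (rule ccontr)
    assume "\<not> ?thesis"
    then have "emeasure lborel X = \<infinity>" by (simp add: less_top[symmetric])
    then show False using assms(4,12) by (simp add: ennreal_mult_top top_unique)
  qed
  \<comment> \<open>\<open>vol_cond\<close> at any point of \<open>X\<close> already provides a
    piece of positive volume.\<close>
  have volX: "0 < measure lborel X"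
  proof -
    obtain x where x: "x \<in> X" using assms by auto
    have "0 < ennreal (\<theta> * v * (D/2) ^ DIM('a))" using assms v by simp
    also have "\<dots> \<le> emeasure lborel (ball x (D/2) \<inter> X)"
      using assms x unfolding vol_cond_def v_def by auto
    also have "\<dots> \<le> emeasure lborel X" using assms by (intro emeasure_mono) auto
    finally have "0 < emeasure lborel X" .
    then show ?thesis using fin by (simp add: measure_def enn2real_positive_iff)
  qed
  \<comment> \<open>Halving \<open>L\<close> absorbs the factor 2 of \<open>bump_sum_holder\<close>;
    halving \<open>T\<close> makes the bound on the labels strict.\<close>
  define A where "A = L / 2"
  define \<tau> where "\<tau> = T / 2"
  define d where "d = real DIM('a)"
  \<comment> \<open>Chosen so that the sample size condition at scale \<open>h\<close> becomes an
    equality exactly when \<open>h powr (d + 2 * \<beta>) = a / s\<close>, where \<open>s\<close> is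
    the effective sample size.\<close>
  define a where "a = measure lborel X / (4 * (A / \<tau>)\<^sup>2 * v)"
  \<comment> \<open>The largest admissible scale: \<open>D / 2\<close> ensures \<open>h < D\<close>
    strictly, and the second entry is the solution of
    \<open>A * h powr \<beta> = \<tau>\<close>.\<close>
  define h0 where "h0 = min (D / 2) ((\<tau> / A) powr (1 / \<beta>))"
  \<comment> \<open>The effective sample size at which the chosen scale equals \<open>h0\<close>;
    beyond it the scale only shrinks.\<close>
  define n0 where "n0 = a / h0 powr (d + 2 * \<beta>)"
  define K where "K = A\<^sup>2 / 2 * \<theta> / 4 ^ DIM('a)"
  define q where "q = 2 * \<beta> / (d + 2 * \<beta>)"
  define C where "C = K * (1/2) powr (2 * \<beta>) * a powr q"
  have pos1: "0 < A" "0 < \<tau>" "0 < d" using assms by (auto simp: A_def \<tau>_def d_def)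
  then have pos2: "0 < a" "0 < h0" "0 < K"
    using assms v volX by (auto simp: a_def h0_def K_def)
  then have "0 < n0" "0 < C" by (auto simp: n0_def C_def)
  note pos = pos1 pos2 this
  show ?thesis
  proof (rule exI[of _ C], intro exI[of _ n0] conjI allI impI; (elim conjE)?)
    fix N :: nat and \<epsilon> :: real and Zs :: "'z measure"
      and M :: "'a \<times> real \<Rightarrow> 'z measure" and est :: "(nat \<Rightarrow> 'a \<times> 'z) \<Rightarrow> 'a \<Rightarrow> real"
    assume \<epsilon>: "0 < \<epsilon>" and N: "n0 \<le> real N * min (\<epsilon>\<^sup>2) 1"
      and M: "label_LDP \<epsilon> Zs M" and est: "estimator N Zs est"
    define s where "s = real N * min (\<epsilon>\<^sup>2) 1"
    have s: "0 < s" "n0 \<le> s" using N pos by (auto simp: s_def)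
    define h where "h = (a / s) powr (1 / (d + 2 * \<beta>))"
    have h0: "0 < h" using pos s by (simp add: h_def)
    have hp: "h powr (d + 2 * \<beta>) = a / s" using pos s assms by (simp add: h_def powr_powr)
    have "h \<le> h0"
    proof -
      have "a \<le> s * h0 powr (d + 2 * \<beta>)"
        using s(2) pos by (simp add: n0_def pos_divide_le_eq)
      then have "a / s \<le> h0 powr (d + 2 * \<beta>)"
        using s(1) by (simp add: pos_divide_le_eq mult.commute)
      then have "h powr (d + 2 * \<beta>) \<le> h0 powr (d + 2 * \<beta>)" unfolding hp .
      then show ?thesis
        using powr_less_mono2[of "d + 2 * \<beta>" h0 h] pos assms by linarith
    qed
    then have hD: "h < D" and hA: "A * h powr \<beta> \<le> \<tau>"
    proof -
      show "h < D" using \<open>h \<le> h0\<close> assms by (simp add: h0_def)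
      have "h powr \<beta> \<le> ((\<tau> / A) powr (1 / \<beta>)) powr \<beta>"
        using \<open>h \<le> h0\<close> assms h0 by (intro powr_mono2) (auto simp: h0_def)
      also have "\<dots> = \<tau> / A" using pos assms by (simp add: powr_powr)
      finally show "A * h powr \<beta> \<le> \<tau>" using pos by (simp add: field_simps)
    qed
    have minsq: "(min \<epsilon> 1)\<^sup>2 = min (\<epsilon>\<^sup>2) 1"
      using \<epsilon> power_le_one[of \<epsilon> 2] one_le_power[of \<epsilon> 2] by (cases "\<epsilon> \<le> 1") auto
    have hsq: "(h powr \<beta>)\<^sup>2 = h powr (2 * \<beta>)"
      by (simp add: power2_eq_square powr_add[symmetric])
    have hd: "h powr (2 * \<beta>) * h ^ DIM('a) = a / s"
      unfolding hp[symmetric] d_def using h0 by (simp add: powr_add powr_realpow)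
    have "4 * real N * (A * h powr \<beta> / \<tau> * min \<epsilon> 1)\<^sup>2 * (v * h ^ DIM('a))
        = 4 * (A / \<tau>)\<^sup>2 * v * s * (h powr (2 * \<beta>) * h ^ DIM('a))"
      by (simp add: power_mult_distrib power_divide hsq minsq s_def)
    also have "\<dots> = measure lborel X"
      unfolding hd using s pos v by (simp add: a_def)
    finally have Ncond: "4 * real N * (A * h powr \<beta> / \<tau> * min \<epsilon> 1)\<^sup>2 * (v * h ^ DIM('a)) \<le> measure lborel X"
      by simp
    \<comment> \<open>Substituting the chosen scale turns \<open>h powr (2 * \<beta>)\<close> into
      \<open>(a / s) powr q\<close>, which is the rate; all other factors are collected in
      \<open>C\<close>.\<close>
    have "A\<^sup>2 * ((h/2) powr \<beta>)\<^sup>2 / 2 * \<theta> / 4 ^ DIM('a) = K * (1/2) powr (2 * \<beta>) * h powr (2 * \<beta>)"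
    proof -
      have "((h/2) powr \<beta>)\<^sup>2 = (h * (1/2)) powr (2 * \<beta>)"
        by (simp add: power2_eq_square powr_add[symmetric])
      also have "\<dots> = h powr (2 * \<beta>) * (1/2) powr (2 * \<beta>)" by (rule powr_mult)
      finally show ?thesis by (simp add: K_def)
    qed
    also have "h powr (2 * \<beta>) = (a / s) powr q" by (simp add: h_def powr_powr q_def)
    also have "\<dots> = a powr q * s powr (- q)" using pos s by (simp add: powr_divide powr_minus_divide)
    finally have Ceq: "A\<^sup>2 * ((h/2) powr \<beta>)\<^sup>2 / 2 * \<theta> / 4 ^ DIM('a) = C * s powr (- q)"
      by (simp add: C_def)
    have X: "X \<in> sets borel" using assms by simp
    have "\<exists>P \<eta>. F_reg1 X L \<beta> c D T \<theta> P \<eta> \<and>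
       ennreal (R_reg_star P \<eta>) + ennreal (C * s powr (- q)) \<le> R_reg N P Zs M est"
      unfolding Ceq[symmetric]
      by (rule minimax_lower_bound_at_scale[OF pos(1) _ assms(2,3,4) pos(2) _ assms(7) X assms(11,12)
            volX fin h0 hD hA Ncond[unfolded v_def] \<epsilon> M est]) (use assms in \<open>auto simp: A_def \<tau>_def\<close>)
    then show "\<exists>P \<eta>. F_reg1 X L \<beta> c D T \<theta> P \<eta> \<and>
       ennreal (R_reg_star P \<eta>) + ennreal (C * (real N * min (\<epsilon>\<^sup>2) 1) powr (- (2 * \<beta> / (DIM('a) + 2 * \<beta>))))
         \<le> R_reg N P Zs M est"
      unfolding s_def q_def d_def .
  qed (rule pos(8))
qed

end
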